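(* No group of the form $A_6:2$ or $A_6:2^2$ possesses a mixed Beauville structure; that is, if $A_6<G\le\mathrm{Aut}(A_6)$ (so $G$ is one of $S_6$, $PGL_2(9)$, $M_{10}$, $P\Gamma L_2(9)=\mathrm{Aut}(A_6)$), then $G$ does not possess a mixed Beauville structure.
   Context: $A_6$ is identified with its group of inner automorphisms; $\mathrm{Aut}(A_6)\cong P\Gamma L_2(9)$ has exactly three index 2 subgroups containing $A_6$, each containing $A_6$ with index 2: $S_6$, $PGL_2(9)$ and the Mathieu group $M_{10}$. The groups of the form $A_6:2$ are these three groups, and the group of the form $A_6:2^2$ is $\mathrm{Aut}(A_6)$. Let $G$ be a finite group. A mixed Beauville structure of $G$ is a set $\{x,y,z\}\subset G$ that generates an index 2 subgroup $G_0<G$ such that for every $g\in G\setminus G_0$: (1) $xyz=1$; (2) $\Sigma(x,y,z)\cap\Sigma(x^g,y^g,z^g)=\{1\}$; (3) $g^2\notin\Sigma(x,y,z)$. Here $x^g$ denotes the conjugate of $x$ by $g$, and for $a,b,c\in G_0$, $\Sigma(a,b,c):=\bigcup_{h\in G_0}\bigcup_{j=0}^{\infty}\{ha^jh^{-1},hb^jh^{-1},hc^jh^{-1}\}$. *)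

theory Defs
  imports "HOL-Algebra.Algebra"
begin

definition inner_automorphisms :: "('a, 'b) monoid_scheme \<Rightarrow> ('a \<Rightarrow> 'a) set" where
  "inner_automorphisms G =
     (\<lambda>g. \<lambda>a\<in>carrier G. g \<otimes>\<^bsub>G\<^esub> a \<otimes>\<^bsub>G\<^esub> inv\<^bsub>G\<^esub> g) ` carrier G"

definition conj_by :: "('a, 'b) monoid_scheme \<Rightarrow> 'a \<Rightarrow> 'a \<Rightarrow> 'a" where
  "conj_by G x g = inv\<^bsub>G\<^esub> g \<otimes>\<^bsub>G\<^esub> x \<otimes>\<^bsub>G\<^esub> g"

(* Conjugates are taken only by elements of the subgroup G0, not by all of G. *)
definition beauville_Sigma ::
  "('a, 'b) monoid_scheme \<Rightarrow> 'a set \<Rightarrow> 'a \<Rightarrow> 'a \<Rightarrow> 'a \<Rightarrow> 'a set" where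
  "beauville_Sigma G G0 a b c =
     (\<Union>h\<in>G0. \<Union>j::nat.
        {h \<otimes>\<^bsub>G\<^esub> (a [^]\<^bsub>G\<^esub> j) \<otimes>\<^bsub>G\<^esub> inv\<^bsub>G\<^esub> h,
         h \<otimes>\<^bsub>G\<^esub> (b [^]\<^bsub>G\<^esub> j) \<otimes>\<^bsub>G\<^esub> inv\<^bsub>G\<^esub> h,
         h \<otimes>\<^bsub>G\<^esub> (c [^]\<^bsub>G\<^esub> j) \<otimes>\<^bsub>G\<^esub> inv\<^bsub>G\<^esub> h})"

(* The order of x, y, z matters in the condition xyz = 1, so a set S qualifies as soon as
   some labelling of it does; x, y, z are not required to be distinct. *)
definition mixed_beauville_structure :: "('a, 'b) monoid_scheme \<Rightarrow> 'a set \<Rightarrow> bool" where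
  "mixed_beauville_structure G S \<longleftrightarrow>
     S \<subseteq> carrier G \<and>
     card (rcosets\<^bsub>G\<^esub> (generate G S)) = 2 \<and>
     (\<exists>x y z. S = {x, y, z} \<and>
        (\<forall>g\<in>carrier G - generate G S.
           x \<otimes>\<^bsub>G\<^esub> y \<otimes>\<^bsub>G\<^esub> z = \<one>\<^bsub>G\<^esub> \<and>
           beauville_Sigma G (generate G S) x y z \<inter>
             beauville_Sigma G (generate G S) (conj_by G x g) (conj_by G y g) (conj_by G z g)
             = {\<one>\<^bsub>G\<^esub>} \<and>
           g [^]\<^bsub>G\<^esub> (2::nat) \<notin> beauville_Sigma G (generate G S) x y z))"

end

theory Submission
  imports Defs
begin

text \<open>
  Let \<open>K\<close> be the index two subgroup generated by a hypothetical structure \<open>{x, y, z}\<close> in a group \<open>G\<close>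
  with \<open>A6 < G \<le> Aut(A6)\<close>. An index two subgroup contains all squares, and every 3-cycle is a square,
  so \<open>A6 \<le> K\<close>. There are two cases.

  If \<open>K\<close> is larger than \<open>A6\<close>, then \<open>G\<close> is all of \<open>Aut(A6)\<close>, because \<open>A6\<close> has index
  at most four in it (\<open>auto_alt_group_6_cases\<close>). This group is generated over \<open>A6\<close> by two
  involutions, conjugation by a transposition and an exotic automorphism that swaps the 3-cycles with
  the products of two 3-cycles. They are not both in \<open>K\<close>, so \<open>g\<^sup>2 = 1\<close> for some \<open>g\<close> outside \<open>K\<close>
  (\<open>index_two_in_Aut6\<close>), which contradicts \<open>g\<^sup>2 \<notin> \<Sigma>(x, y, z)\<close>.

  If \<open>K = A6\<close>, the disjointness condition decides. An element of \<open>A6\<close> whose cube is not the identity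
  has a power of order 2 or 5 (\<open>alt_group_6_order_cases\<close>). All involutions of \<open>A6\<close> are conjugate,
  and of two elements of order 5 each is conjugate to a power of the other
  (\<open>alt_group_6_conjugate_to_power\<close>); hence no automorphism can move that power away from the conjugates
  of its own powers. So \<open>x\<close>, \<open>y\<close> and \<open>z\<close> have cube 1, and \<open>A6\<close> is a quotient of the triangle group
  \<open>(3, 3, 3)\<close>. That group is a crystallographic group of the plane and therefore solvable
  (\<open>triangle_333_solvable\<close>), whereas \<open>A6\<close> is not.

  The bound on the automorphisms comes from the four 3-cycles \<open>(1 2 k)\<close>. Up to the exotic automorphism,
  an automorphism sends 3-cycles to 3-cycles. The product of two distinct cycles among those four has order 2, and this
  forces their images to be \<open>(a b y)\<close> with a common oriented edge \<open>a b\<close> and distinct \<open>y\<close>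
  (\<open>three_cycle_meets_in_edge\<close>, \<open>three_cycles_share_edge\<close>), so the automorphism is
  conjugation by a permutation.
\<close>

section \<open>Index two subgroups and a solvable triangle group\<close>

text \<open>
  Both \<open>K g\<close> and \<open>K h\<inverse>\<close> must be the only coset of \<open>K\<close> different from \<open>K\<close>.
\<close>

lemma (in group) mult_in_index_two_subgroup:
  assumes K: "subgroup K G" and two: "card (rcosets K) = 2"
    and g: "g \<in> carrier G - K" and h: "h \<in> carrier G - K"
  shows "g \<otimes> h \<in> K"
proof -
  have coset_ne: "K #> x \<noteq> K" if "x \<in> carrier G - K" for x
    using that coset_join1[of K x] K subgroup.subset by blast
  have ih: "inv h \<in> carrier G - K" using h subgroup.m_inv_closed[OF K, of "inv h"] by auto
  have "K \<in> rcosets K" using coset_mult_one[OF subgroup.subset[OF K]] rcosetsI[OF subgroup.subset[OF K], of \<one>] by simp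
  moreover have "K #> g \<in> rcosets K" "K #> inv h \<in> rcosets K"
    using g h K subgroup.subset by (auto intro!: rcosetsI)
  moreover obtain P Q where "rcosets K = {P, Q}" using two by (meson card_2_iff)
  ultimately have "K #> g = K #> inv h" using coset_ne[OF g] coset_ne[OF ih] by auto
  then have "g \<in> K #> inv h" using rcos_self[of g K] g K by auto
  then obtain k where k: "k \<in> K" "g = k \<otimes> inv h" by (auto simp: r_coset_def)
  have "g \<otimes> h = k" using k h subgroup.mem_carrier[OF K k(1)] by (simp add: m_assoc)
  then show ?thesis using k(1) by simp
qed

lemma (in group) inv_commutes:
  assumes "x \<otimes> s = s \<otimes> x" "x \<in> carrier G" "s \<in> carrier G"
  shows "inv x \<otimes> s = s \<otimes> inv x"
proof -
  have "inv x \<otimes> s = inv x \<otimes> (s \<otimes> x) \<otimes> inv x" using assms(2,3) by (simp add: m_assoc)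
  also have "\<dots> = s \<otimes> inv x" unfolding assms(1)[symmetric] using assms(2,3) by (simp add: m_assoc[symmetric])
  finally show ?thesis .
qed

lemma (in group) generate_commute:
  assumes S: "S \<subseteq> carrier G" and comm: "\<And>x y. x \<in> S \<Longrightarrow> y \<in> S \<Longrightarrow> x \<otimes> y = y \<otimes> x"
    and x: "x \<in> generate G S" and y: "y \<in> generate G S"
  shows "x \<otimes> y = y \<otimes> x"
proof -
  have centr: "subgroup {g \<in> carrier G. \<forall>s\<in>A. g \<otimes> s = s \<otimes> g} G" if "A \<subseteq> carrier G" for A
  proof (rule subgroupI)
    show "{g \<in> carrier G. \<forall>s\<in>A. g \<otimes> s = s \<otimes> g} \<noteq> {}" using that by (auto intro!: exI[of _ \<one>])
    show "inv a \<in> {g \<in> carrier G. \<forall>s\<in>A. g \<otimes> s = s \<otimes> g}" if "a \<in> {g \<in> carrier G. \<forall>s\<in>A. g \<otimes> s = s \<otimes> g}" for a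
    proof -
      have "inv a \<otimes> s = s \<otimes> inv a" if "s \<in> A" for s
        using that \<open>a \<in> _\<close> \<open>A \<subseteq> carrier G\<close> by (intro inv_commutes) auto
      then show ?thesis using that by auto
    qed
    show "a \<otimes> b \<in> {g \<in> carrier G. \<forall>s\<in>A. g \<otimes> s = s \<otimes> g}"
      if "a \<in> {g \<in> carrier G. \<forall>s\<in>A. g \<otimes> s = s \<otimes> g}" "b \<in> {g \<in> carrier G. \<forall>s\<in>A. g \<otimes> s = s \<otimes> g}" for a b
    proof -
      have "(a \<otimes> b) \<otimes> s = s \<otimes> (a \<otimes> b)" if "s \<in> A" for s
      proof -
        have c: "a \<in> carrier G" "b \<in> carrier G" "s \<in> carrier G" "a \<otimes> s = s \<otimes> a" "b \<otimes> s = s \<otimes> b"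
          using that \<open>a \<in> _\<close> \<open>b \<in> _\<close> \<open>A \<subseteq> carrier G\<close> by auto
        then show ?thesis by (metis m_assoc)
      qed
      then show ?thesis using that by auto
    qed
  qed auto
  have "generate G S \<subseteq> {g \<in> carrier G. \<forall>s\<in>S. g \<otimes> s = s \<otimes> g}"
    by (rule generate_subgroup_incl[OF _ centr[OF S]]) (use S comm in auto)
  then have "S \<subseteq> {g \<in> carrier G. \<forall>s\<in>generate G S. g \<otimes> s = s \<otimes> g}" using S by auto
  then have "generate G S \<subseteq> {g \<in> carrier G. \<forall>s\<in>generate G S. g \<otimes> s = s \<otimes> g}"
    by (rule generate_subgroup_incl[OF _ centr[OF generate_incl[OF S]]])
  then show ?thesis using x y by auto
qed

text \<open>
  In the Euclidean realisation \<open>a\<close> and \<open>b\<close> are rotations by the same angle, so \<open>a b\<inverse>\<close> and its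
  conjugates are translations. With \<open>b\<inverse> = b b\<close> these are \<open>u\<close>, \<open>v\<close> and \<open>w\<close> below: translations
  along the three sides of a triangle, which commute, have product 1 and are permuted cyclically by
  conjugation with \<open>a\<close>. They generate an abelian normal subgroup, and modulo it \<open>a\<close> and \<open>b\<close>
  coincide, so the quotient is cyclic.
\<close>

lemma (in group) triangle_333_solvable:
  assumes a: "a \<in> carrier G" and b: "b \<in> carrier G" and gen: "generate G {a, b} = carrier G"
    and a3: "a \<otimes> a \<otimes> a = \<one>" and b3: "b \<otimes> b \<otimes> b = \<one>"
    and ab3: "a \<otimes> b \<otimes> (a \<otimes> b) \<otimes> (a \<otimes> b) = \<one>"
  shows "solvable G"
proof -
  define u v w where "u = a \<otimes> b \<otimes> b" and "v = b \<otimes> b \<otimes> a" and "w = b \<otimes> a \<otimes> b"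
  have [simp]: "u \<in> carrier G" "v \<in> carrier G" "w \<in> carrier G" using a b by (simp_all add: u_def v_def w_def)
  have A: "a \<otimes> (a \<otimes> (a \<otimes> x)) = x" and B: "b \<otimes> (b \<otimes> (b \<otimes> x)) = x"
    and AB: "a \<otimes> (b \<otimes> (a \<otimes> (b \<otimes> (a \<otimes> (b \<otimes> x))))) = x" if "x \<in> carrier G" for x
    using that a b arg_cong[OF a3, of "\<lambda>y. y \<otimes> x"] arg_cong[OF b3, of "\<lambda>y. y \<otimes> x"]
      arg_cong[OF ab3, of "\<lambda>y. y \<otimes> x"] by (simp_all add: m_assoc)
  have A0: "a \<otimes> (a \<otimes> a) = \<one>" and B0: "b \<otimes> (b \<otimes> b) = \<one>" 
    and AB0: "a \<otimes> (b \<otimes> (a \<otimes> (b \<otimes> (a \<otimes> b)))) = \<one>"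
    using a3 b3 ab3 a b by (simp_all add: m_assoc)
  have uv: "u \<otimes> v = a \<otimes> (b \<otimes> a)" using a b B by (simp add: u_def v_def m_assoc)
  have "(u \<otimes> v) \<otimes> w = \<one>" unfolding uv w_def using a b AB0 by (simp add: m_assoc)
  then have uv_inv: "u \<otimes> v = inv w" by (simp add: inv_equality)
  have "(v \<otimes> u) \<otimes> w = \<one>" using a b A B B0 by (simp add: u_def v_def w_def m_assoc)
  then have vu_inv: "v \<otimes> u = inv w" by (simp add: inv_equality)
  have wi: "w = inv (u \<otimes> v)" by (simp add: uv_inv)
  have cu: "u \<otimes> v = v \<otimes> u" by (simp add: uv_inv vu_inv)
  have cw: "u \<otimes> w = w \<otimes> u" "v \<otimes> w = w \<otimes> v"
  proof -
    have "(u \<otimes> v) \<otimes> u = u \<otimes> (u \<otimes> v)" "(u \<otimes> v) \<otimes> v = v \<otimes> (u \<otimes> v)"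
      by (metis cu m_assoc \<open>u \<in> carrier G\<close> \<open>v \<in> carrier G\<close>)+
    then show "u \<otimes> w = w \<otimes> u" "v \<otimes> w = w \<otimes> v"
      unfolding wi by (metis inv_commutes m_closed \<open>u \<in> carrier G\<close> \<open>v \<in> carrier G\<close>)+
  qed
  have av: "a \<otimes> v = u \<otimes> a" using a b by (simp add: u_def v_def m_assoc)
  have aw: "a \<otimes> w = v \<otimes> a"
  proof -
    have "(a \<otimes> w) \<otimes> (a \<otimes> b) = \<one>" "(v \<otimes> a) \<otimes> (a \<otimes> b) = \<one>"
      using a b AB0 A B0 by (simp_all add: u_def v_def w_def m_assoc)
    then show ?thesis using a b by (metis inv_equality m_closed \<open>v \<in> carrier G\<close> \<open>w \<in> carrier G\<close>)
  qed
  have au: "a \<otimes> u = w \<otimes> a"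
  proof -
    have "b \<otimes> (a \<otimes> (b \<otimes> (a \<otimes> (b \<otimes> a)))) \<otimes> b = \<one> \<otimes> b"
      using a b AB0 by (simp add: m_assoc)
    then have "b \<otimes> (a \<otimes> (b \<otimes> (a \<otimes> (b \<otimes> a)))) = \<one>" by (rule r_cancel) (use a b in auto)
    then have "(w \<otimes> a) \<otimes> (b \<otimes> a) = \<one>" "(a \<otimes> u) \<otimes> (b \<otimes> a) = \<one>"
      using a b A0 B by (simp_all add: u_def w_def m_assoc)
    then show ?thesis using a b by (metis inv_equality m_closed \<open>u \<in> carrier G\<close> \<open>w \<in> carrier G\<close>)
  qed
  define T where "T = generate G {u, v, w}"
  have pair: "x \<otimes> y = y \<otimes> x" if "x \<in> {u, v, w}" "y \<in> {u, v, w}" for x y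
    using that cu cw by (elim insertE emptyE) (simp_all only:)
  have Tc: "x \<otimes> y = y \<otimes> x" if "x \<in> T" "y \<in> T" for x y
    by (rule generate_commute[OF _ pair that[unfolded T_def]]) auto
  have ca: "a \<otimes> v \<otimes> inv a = u" "a \<otimes> w \<otimes> inv a = v" "a \<otimes> u \<otimes> inv a = w"
    unfolding av aw au using a by (simp_all add: m_assoc)
  have ca': "inv a \<otimes> u \<otimes> a = v" "inv a \<otimes> v \<otimes> a = w" "inv a \<otimes> w \<otimes> a = u"
    using a av[symmetric] aw[symmetric] au[symmetric] by (simp_all add: m_assoc inv_solve_left')
  have ub: "b = inv u \<otimes> a"
  proof -
    have "u \<otimes> b = a" using a b B0 by (simp add: u_def m_assoc)
    then show ?thesis using a b by (simp add: inv_solve_left)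
  qed
  have ui: "u \<otimes> (inv u \<otimes> y) = y" "inv u \<otimes> (u \<otimes> y) = y" if "y \<in> carrier G" for y
    using that by (simp_all add: m_assoc[symmetric])
  have triple: "g \<otimes> x \<otimes> inv g \<in> {u, v, w}" if "g \<in> generate G {a, b}" "x \<in> {u, v, w}" for g x
    using that
  proof (induction arbitrary: x)
    case one
    then show ?case by auto
  next
    case (incl h)
    have 1: "a \<otimes> x \<otimes> inv a \<in> {u, v, w}" using incl.prems ca by auto
    have "b \<otimes> x \<otimes> inv b = inv u \<otimes> (a \<otimes> x \<otimes> inv a) \<otimes> u"
      unfolding ub using a incl.prems by (auto simp: inv_mult_group m_assoc ui)
    also have "\<dots> = a \<otimes> x \<otimes> inv a"
    proof -
      have c: "a \<otimes> x \<otimes> inv a \<in> carrier G" using a incl.prems by auto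
      have "a \<otimes> x \<otimes> inv a \<otimes> u = u \<otimes> (a \<otimes> x \<otimes> inv a)" by (rule pair[OF 1]) simp
      then show ?thesis using c by (simp only: m_assoc inv_closed \<open>u \<in> carrier G\<close>) (simp add: m_assoc[symmetric])
    qed
    finally show ?case using incl.hyps 1 by auto
  next
    case (inv h)
    have 1: "inv a \<otimes> x \<otimes> a \<in> {u, v, w}" if "x \<in> {u, v, w}" for x using that ca' by auto
    have "inv b \<otimes> x \<otimes> inv (inv b) = inv a \<otimes> (u \<otimes> x \<otimes> inv u) \<otimes> a"
      unfolding ub using a inv.prems by (auto simp: inv_mult_group m_assoc ui)
    also have "u \<otimes> x \<otimes> inv u = x"
    proof -
      have "x \<in> carrier G" using inv.prems by auto
      moreover have "u \<otimes> x = x \<otimes> u" by (rule pair[OF _ inv.prems]) simp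
      ultimately show ?thesis by (simp add: m_assoc)
    qed
    finally have 2: "inv b \<otimes> x \<otimes> inv (inv b) = inv a \<otimes> x \<otimes> a" .
    from inv.hyps show ?case
    proof (elim insertE emptyE)
      assume h: "h = a"
      show ?thesis unfolding h inv_inv[OF a] by (rule 1[OF inv.prems])
    next
      assume h: "h = b"
      show ?thesis unfolding h 2 by (rule 1[OF inv.prems])
    qed
  next
    case (eng g h)
    have c: "g \<in> carrier G" "h \<in> carrier G" "x \<in> carrier G"
      using eng.hyps gen eng.prems \<open>u \<in> carrier G\<close> \<open>v \<in> carrier G\<close> \<open>w \<in> carrier G\<close> by blast+
    have "g \<otimes> h \<otimes> x \<otimes> inv (g \<otimes> h) = g \<otimes> (h \<otimes> x \<otimes> inv h) \<otimes> inv g"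
      using c by (simp add: inv_mult_group m_assoc)
    then show ?case using eng by simp
  qed
  have normal: "T \<lhd> G"
    unfolding T_def by (rule normal_generateI) (use triple gen in auto)
  interpret T: normal T G by (rule normal)
  interpret Q: group "G Mod T" by (rule T.factorgroup_is_group)
  interpret q: group_hom G "G Mod T" "\<lambda>x. T #> x"
    by unfold_locales (rule T.r_coset_hom_Mod)
  have uT: "u \<in> T" unfolding T_def by (rule generate.incl) simp
  have "T #> b = (T #> inv u) \<otimes>\<^bsub>G Mod T\<^esub> (T #> a)" unfolding ub using a by simp
  also have "T #> inv u = \<one>\<^bsub>G Mod T\<^esub>"
    using T.rcos_const[OF is_group T.m_inv_closed[OF uT]] by (simp add: FactGroup_def)
  also have "\<one>\<^bsub>G Mod T\<^esub> \<otimes>\<^bsub>G Mod T\<^esub> (T #> a) = T #> a" using a by (intro Q.l_one) simp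
  finally have qb: "T #> b = T #> a" .
  have "carrier (G Mod T) = (\<lambda>x. T #> x) ` carrier G" by (auto simp: FactGroup_def RCOSETS_def)
  also have "\<dots> = generate (G Mod T) {T #> a}"
    using q.generate_img[of "{a, b}"] a b gen qb by simp
  also have "\<dots> = range (\<lambda>n::int. (T #> a) [^]\<^bsub>G Mod T\<^esub> n)"
    using Q.generate_pow[OF q.hom_closed[OF a]] by (simp add: full_SetCompr_eq)
  finally have "cyclic_group (G Mod T)"
    unfolding Q.cyclic_group using q.hom_closed[OF a] by blast
  then have "derived G (carrier G) \<subseteq> T"
    by (intro derived_minimal normal Q.cyclic_imp_abelian_group)
  then have "derived G (derived G (carrier G)) \<subseteq> derived G T"
    by (rule mono_derived)
  also have "\<dots> \<subseteq> {\<one>}"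
  proof -
    have "x \<otimes> y \<otimes> inv x \<otimes> inv y = \<one>" if "x \<in> T" "y \<in> T" for x y
      using Tc[OF that] T.mem_carrier[OF that(1)] T.mem_carrier[OF that(2)] by (simp add: m_assoc)
    then have "derived_set G T \<subseteq> {\<one>}" by auto
    then show ?thesis unfolding derived_def by (rule generate_subgroup_incl[OF _ triv_subgroup])
  qed
  finally have "(derived G ^^ 2) (carrier G) = {\<one>}"
    using generate.one[of G] by (auto simp: numeral_2_eq_2 derived_def)
  then show ?thesis using solvable_iff_trivial_derived_seq by blast
qed

lemma (in group) index_two_proper:
  assumes K: "subgroup K G" and two: "card (rcosets K) = 2"
  obtains g where "g \<in> carrier G - K"
proof -
  have "rcosets K = {K}" if "carrier G \<subseteq> K"
  proof -
    have "K #> g = K" if "g \<in> carrier G" for g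
      using coset_join2[OF that K] that \<open>carrier G \<subseteq> K\<close> by blast
    then show ?thesis unfolding RCOSETS_def using one_closed by blast
  qed
  then have "\<not> carrier G \<subseteq> K" using two by auto
  then show thesis using that by blast
qed

section \<open>Cycle types of permutations of a finite set\<close>

lemma ex_permutes_map_lists:
  assumes "finite S" "distinct xs" "distinct ys" "length xs = length ys" "set xs \<subseteq> S" "set ys \<subseteq> S"
  shows "\<exists>r. r permutes S \<and> map r xs = ys"
proof -
  obtain xs' where xs': "set xs' = S - set xs" "distinct xs'"
    using finite_distinct_list[of "S - set xs"] assms(1) by auto
  obtain ys' where ys': "set ys' = S - set ys" "distinct ys'"
    using finite_distinct_list[of "S - set ys"] assms(1) by auto
  have "length xs' = card S - length xs"
    using distinct_card[OF xs'(2)] distinct_card[OF assms(2)] assms(1,5) xs'(1)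
    by (metis card_Diff_subset finite_set)
  moreover have "length ys' = card S - length ys"
    using distinct_card[OF ys'(2)] distinct_card[OF assms(3)] assms(1,6) ys'(1)
    by (metis card_Diff_subset finite_set)
  ultimately have len: "length (xs @ xs') = length (ys @ ys')"
    using assms(4) by simp
  have dx: "distinct (xs @ xs')" and dy: "distinct (ys @ ys')"
    using assms(2,3) xs' ys' by auto
  have sx: "set (xs @ xs') = S" and sy: "set (ys @ ys') = S"
    using assms(5,6) xs'(1) ys'(1) by auto
  let ?l = "zip (xs @ xs') (ys @ ys')"
  have "list_permutes ?l S"
    using len dx dy sx sy by (intro list_permutesI) auto
  then have "permutation_of_list ?l permutes S"
    by (rule permutation_of_list_permutes)
  moreover have "permutation_of_list ?l (xs ! i) = ys ! i" if "i < length xs" for i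
  proof -
    have "map_of ?l ((xs @ xs') ! i) = Some ((ys @ ys') ! i)"
      using len dx that by (intro map_of_zip_nth) auto
    then show ?thesis
      using that assms(4) by (simp add: nth_append permutation_of_list_def)
  qed
  then have "map (permutation_of_list ?l) xs = ys"
    using assms(4) by (intro nth_equalityI) auto
  ultimately show ?thesis by blast
qed

text \<open>
  This records a cycle decomposition pointwise rather than as a product, so that the order of the
  cycles is irrelevant and they can be sorted by length. Fixed points appear as cycles of length one.
\<close>

definition cycle_partition :: "'a set \<Rightarrow> ('a \<Rightarrow> 'a) \<Rightarrow> 'a list list \<Rightarrow> bool" where
  "cycle_partition S p css \<longleftrightarrow> [] \<notin> set css \<and> distinct (concat css) \<and> set (concat css) = S \<and>
     (\<forall>cs\<in>set css. \<forall>x\<in>set cs. p x = cycle_of_list cs x)"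

lemma evenperm_cycle_of_list:
  assumes "distinct cs" "cs \<noteq> []"
  shows "evenperm (cycle_of_list cs) \<longleftrightarrow> odd (length cs)"
proof -
  have "swapidseq (length cs - 1) (cycle_of_list cs)"
    using swapidseq_ext_imp_swapidseq[OF swapidseq_ext_of_cycles[OF assms(1)]] .
  then have "evenperm (cycle_of_list cs) \<longleftrightarrow> even (length cs - 1)"
    by (rule evenperm_unique) simp
  then show ?thesis using assms(2) by (cases cs) auto
qed

text \<open>
  The parity is carried along because a cycle of length \<open>l\<close> is a product of \<open>l - 1\<close> transpositions:
  it selects the even cycle types at once.
\<close>

lemma cycle_decomp_imp_cycle_partition:
  assumes "cycle_decomp S p"
  shows "p permutes S \<and> (\<exists>css. cycle_partition S p css \<and> (evenperm p \<longleftrightarrow> even (card S + length css)))"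
  using assms
proof induction
  case empty
  have "cycle_partition {} id []" by (simp add: cycle_partition_def)
  then show ?case
    by (metis add.right_neutral card.empty even_zero evenperm_id list.size(3) permutes_id)
next
  case (comp I p cs)
  from comp.IH obtain css where p: "p permutes I" and css: "cycle_partition I p css"
    and par: "evenperm p \<longleftrightarrow> even (card I + length css)" by blast
  have fin: "finite I" using css by (auto simp: cycle_partition_def)
  have perm: "cycle_of_list cs \<circ> p permutes set cs \<union> I"
    using p cycle_permutes[of cs] by (meson permutes_compose permutes_subset sup_ge1 sup_ge2)
  show ?case
  proof (cases "cs = []")
    case True
    then show ?thesis using p css par by auto
  next
    case False
    have a: "(cycle_of_list cs \<circ> p) x = cycle_of_list cs x" if "x \<in> set cs" for x
      using that comp.hyps p by (auto simp: permutes_def)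
    have b: "(cycle_of_list cs \<circ> p) x = cycle_of_list ds x" if "ds \<in> set css" "x \<in> set ds" for ds x
    proof -
      have "p x = cycle_of_list ds x" "x \<in> I" using that css by (auto simp: cycle_partition_def)
      moreover have "p x \<in> I" using \<open>x \<in> I\<close> p by (simp add: permutes_in_image)
      ultimately show ?thesis using comp.hyps id_outside_supp[of "p x" cs] by auto
    qed
    have "cycle_partition (set cs \<union> I) (cycle_of_list cs \<circ> p) (cs # css)"
      using css comp.hyps False a b unfolding cycle_partition_def by auto
    moreover have "evenperm (cycle_of_list cs \<circ> p) \<longleftrightarrow> (evenperm (cycle_of_list cs) \<longleftrightarrow> evenperm p)"
      using p fin by (intro evenperm_comp permutation_of_cycle) (auto simp: permutation_permutes)
    moreover have "card (set cs \<union> I) = length cs + card I"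
      using comp.hyps fin by (subst card_Un_disjoint) (auto simp: distinct_card)
    ultimately have "cycle_partition (set cs \<union> I) (cycle_of_list cs \<circ> p) (cs # css) \<and>
      (evenperm (cycle_of_list cs \<circ> p) \<longleftrightarrow> even (card (set cs \<union> I) + length (cs # css)))"
      using par evenperm_cycle_of_list[OF comp.hyps(2) False] by auto
    then show ?thesis using perm by blast
  qed
qed

lemma cycle_partition_cong_mset:
  assumes "mset css = mset dss" "cycle_partition S p css"
  shows "cycle_partition S p dss"
proof -
  have "mset (concat xss) = (\<Sum>xs\<in>#mset xss. mset xs)" for xss :: "'a list list"
    by (induction xss) auto
  then have "mset (concat css) = mset (concat dss)" using assms(1) by simp
  then have "distinct (concat css) = distinct (concat dss)" "set (concat css) = set (concat dss)"
    using mset_eq_imp_distinct_iff mset_eq_setD by blast+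
  moreover have "set css = set dss" using assms(1) by (rule mset_eq_setD)
  ultimately show ?thesis using assms(2) unfolding cycle_partition_def by auto
qed

lemma ex_sorted_cycle_partition:
  assumes "p permutes S" "finite S"
  shows "\<exists>css. cycle_partition S p css \<and> sorted (map length css) \<and>
           (evenperm p \<longleftrightarrow> even (card S + length css))"
proof -
  obtain css where "cycle_partition S p css" "evenperm p \<longleftrightarrow> even (card S + length css)"
    using cycle_decomp_imp_cycle_partition[OF cycle_decomposition[OF assms]] by blast
  then show ?thesis
    using cycle_partition_cong_mset[of css "sort_key length css" S p]
    by (intro exI[of _ "sort_key length css"]) auto
qed

lemma map_concat_eq_imp:
  assumes "map length css = map length dss" "map r (concat css) = concat dss"
  shows "map (map r) css = dss"
  using assms by (induction css dss rule: list_induct2') auto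

text \<open>
  The conjugating permutation writes the cycles of \<open>q\<close> below those of \<open>p\<close>.
\<close>

lemma same_cycle_type_conjugate:
  assumes "cycle_partition S p css" "cycle_partition S q dss" "map length css = map length dss"
    and p: "p permutes S" and q: "q permutes S"
  shows "\<exists>r. r permutes S \<and> r \<circ> p = q \<circ> r"
proof -
  have fin: "finite S" using assms(1) by (auto simp: cycle_partition_def)
  have "length (concat css) = length (concat dss)" using assms(3) by (simp add: length_concat)
  then obtain r where r: "r permutes S" "map r (concat css) = concat dss"
    using ex_permutes_map_lists[of S "concat css" "concat dss"] assms(1,2) fin
    unfolding cycle_partition_def by blast
  have dss: "dss = map (map r) css" using map_concat_eq_imp[OF assms(3) r(2)] by simp
  have "r (p x) = q (r x)" for x
  proof (cases "x \<in> S")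
    case True
    then obtain cs where cs: "cs \<in> set css" "x \<in> set cs" using assms(1) by (auto simp: cycle_partition_def)
    have "distinct cs" using cs(1) assms(1)
      by (auto simp: cycle_partition_def distinct_concat_iff)
    then have *: "r \<circ> cycle_of_list cs \<circ> inv' r = cycle_of_list (map r cs)"
      using r(1) by (intro conjugation_of_cycle permutes_bij)
    have "q (r x) = cycle_of_list (map r cs) (r x)"
      using assms(2) cs unfolding cycle_partition_def dss by auto
    also have "\<dots> = r (cycle_of_list cs x)"
      unfolding *[symmetric] using permutes_inverses(2)[OF r(1)] by simp
    also have "cycle_of_list cs x = p x"
      using assms(1) cs by (auto simp: cycle_partition_def)
    finally show ?thesis ..
  next
    case False
    then show ?thesis using p q r(1) by (simp add: permutes_not_in)
  qed
  then show ?thesis using r(1) by (intro exI[of _ r]) auto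
qed

lemma even_partitions_of_six:
  fixes ls :: "nat list"
  assumes "sorted ls" "0 \<notin> set ls" "sum_list ls = 6" "even (length ls)"
  shows "ls \<in> {[1,1,1,1,1,1], [1,1,2,2], [1,1,1,3], [3,3], [2,4], [1,5]}"
proof -
  have "length ls \<le> sum_list ls"
    using assms(2) by (induction ls) (auto simp: Suc_le_eq)
  moreover obtain k where k: "length ls = 2 * k" using assms(4) by (elim evenE)
  moreover have "k \<noteq> 0" using assms(3) k by (cases ls) auto
  ultimately have "k = 1 \<or> k = 2 \<or> k = 3" using assms(3) by linarith
  then consider a b where "ls = [a,b]" | a b c d where "ls = [a,b,c,d]"
    | a b c d e f where "ls = [a,b,c,d,e,f]"
    using k by (auto simp: numeral_eq_Suc length_Suc_conv)
  then show ?thesis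
  proof cases
    case 1
    then have "0 < a" "a \<le> b" "a + b = 6" using assms by auto
    then have "a = 1 \<or> a = 2 \<or> a = 3" by linarith
    then show ?thesis using 1 \<open>a + b = 6\<close> by auto
  next
    case 2
    then have *: "0 < a" "a \<le> b" "b \<le> c" "c \<le> d" "a + b + c + d = 6" using assms by auto
    then have "a = 1" "b = 1" "c = 1 \<or> c = 2" by linarith+
    then show ?thesis using 2 * by auto
  next
    case 3
    then have "0 < a" "0 < b" "0 < c" "0 < d" "0 < e" "0 < f" "a + b + c + d + e + f = 6"
      using assms by auto
    then have "a = 1" "b = 1" "c = 1" "d = 1" "e = 1" "f = 1" by linarith+
    then show ?thesis using 3 by simp
  qed
qed

section \<open>Conjugacy classes of the alternating group of degree six\<close>

lemma alt_comp: "p \<in> carrier (alt_group n) \<Longrightarrow> q \<in> carrier (alt_group n) \<Longrightarrow> p \<circ> q \<in> carrier (alt_group n)"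
  using group.is_monoid[OF alt_group_is_group[of n], THEN monoid.m_closed, of p q] by (simp add: alt_group_mult)

definition cycle_product :: "'a list list \<Rightarrow> 'a \<Rightarrow> 'a" where
  "cycle_product css = foldr (\<lambda>cs p. cycle_of_list cs \<circ> p) css id"

lemma cycle_product_partition:
  assumes "distinct (concat css)" "[] \<notin> set css"
  shows "cycle_product css permutes set (concat css) \<and> cycle_partition (set (concat css)) (cycle_product css) css"
  using assms
proof (induction css)
  case Nil
  then show ?case by (simp add: cycle_product_def cycle_partition_def permutes_id[unfolded id_def] id_def)
next
  case (Cons cs css)
  let ?p = "cycle_product css"
  have cp: "cycle_product (cs # css) = cycle_of_list cs \<circ> ?p" by (simp add: cycle_product_def)
  have dis: "set cs \<inter> set (concat css) = {}" using Cons.prems by auto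
  have p: "?p permutes set (concat css)" and part: "cycle_partition (set (concat css)) ?p css"
    using Cons by auto
  have "cycle_product (cs # css) permutes set cs \<union> set (concat css)"
    unfolding cp using p cycle_permutes[of cs]
    by (meson permutes_compose permutes_subset sup_ge1 sup_ge2)
  moreover have "cycle_product (cs # css) x = cycle_of_list cs x" if "x \<in> set cs" for x
  proof -
    have "x \<notin> set (concat css)" using that dis by blast
    then show ?thesis using permutes_not_in[OF p] unfolding cp by simp
  qed
  moreover have "cycle_product (cs # css) x = cycle_of_list ds x" if "ds \<in> set css" "x \<in> set ds" for ds x
  proof -
    have "?p x = cycle_of_list ds x" using part that by (auto simp: cycle_partition_def)
    moreover have "?p x \<in> set (concat css)" using that permutes_in_image[OF p, of x] by auto
    ultimately show ?thesis using dis id_outside_supp[of "?p x" cs] unfolding cp by auto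
  qed
  ultimately show ?case using Cons.prems by (auto simp: cycle_partition_def)
qed

lemma eq_on_six_points:
  fixes f g :: "nat \<Rightarrow> 'a"
  assumes "\<And>x. x \<notin> {1,2,3,4,5,6} \<Longrightarrow> f x = g x"
    and "f 1 = g 1" "f 2 = g 2" "f 3 = g 3" "f 4 = g 4" "f 5 = g 5" "f 6 = g 6"
  shows "f = g"
proof
  fix x show "f x = g x"
    using assms by (cases "x \<in> {1,2,3,4,5,6}") (elim insertE, simp_all only: empty_iff)
qed

abbreviation "rep22 \<equiv> cycle_of_list [1,2::nat] \<circ> cycle_of_list [3,4]"
abbreviation "rep3 \<equiv> cycle_of_list [1,2,3::nat]"
abbreviation "rep33 \<equiv> cycle_of_list [1,2,3::nat] \<circ> cycle_of_list [4,5,6]"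
abbreviation "rep24 \<equiv> cycle_of_list [1,2::nat] \<circ> cycle_of_list [3,4,5,6]"
abbreviation "rep5 \<equiv> cycle_of_list [1,2,3,4,5::nat]"

lemma alt_group_6_sym_conjugate:
  assumes "a \<in> carrier (alt_group 6)"
  shows "\<exists>r q. r permutes {1..6} \<and> q \<in> {id, rep22, rep3, rep33, rep24, rep5} \<and> r \<circ> a = q \<circ> r"
proof -
  have a: "a permutes {1..6}" "evenperm a" using assms by (auto simp only: alt_group_carrier)
  obtain css where css: "cycle_partition {1..6} a css" "sorted (map length css)"
    and par: "even (6 + length css)"
    using ex_sorted_cycle_partition[OF a(1)] a(2) by auto
  have "length (concat css) = card {1..6::nat}"
    using css(1) distinct_card[of "concat css"] unfolding cycle_partition_def by simp
  then have "sum_list (map length css) = 6" by (simp add: length_concat)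
  moreover have "0 \<notin> set (map length css)" using css(1) by (auto simp: cycle_partition_def)
  ultimately have ls: "map length css \<in> {[1,1,1,1,1,1], [1,1,2,2], [1,1,1,3], [3,3], [2,4], [1,5]}"
    using even_partitions_of_six[of "map length css"] css(2) par by simp
  have conj: ?thesis if "map length css = map length dss" "cycle_product dss = q" "distinct (concat dss)" 
     "set (concat dss) = {1..6}" "[] \<notin> set dss" "q \<in> {id, rep22, rep3, rep33, rep24, rep5}" for q dss
  proof -
    have "q permutes {1..6}" "cycle_partition {1..6} q dss"
      using cycle_product_partition[OF that(3,5)] unfolding that(2,4) by blast+
    then show ?thesis using same_cycle_type_conjugate[OF css(1) _ that(1) a(1)] that(6) by blast
  qed
  from ls consider "map length css = [1,1,1,1,1,1]" | "map length css = [1,1,2,2]"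
    | "map length css = [1,1,1,3]" | "map length css = [3,3]" | "map length css = [2,4]" | "map length css = [1,5]"
    by blast
  then show ?thesis
  proof cases
    case 1 show ?thesis by (rule conj[of "[[1],[2],[3],[4],[5],[6]]" id]) (use 1 in \<open>auto simp: cycle_product_def\<close>)
  next
    case 2 show ?thesis by (rule conj[of "[[5],[6],[1,2],[3,4]]" rep22]) (use 2 in \<open>auto simp: cycle_product_def\<close>)
  next
    case 3 show ?thesis by (rule conj[of "[[4],[5],[6],[1,2,3]]" rep3]) (use 3 in \<open>auto simp: cycle_product_def\<close>)
  next
    case 4 show ?thesis by (rule conj[of "[[1,2,3],[4,5,6]]" rep33]) (use 4 in \<open>auto simp: cycle_product_def\<close>)
  next
    case 5 show ?thesis by (rule conj[of "[[1,2],[3,4,5,6]]" rep24]) (use 5 in \<open>auto simp: cycle_product_def\<close>)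
  next
    case 6 show ?thesis by (rule conj[of "[[6],[1,2,3,4,5]]" rep5]) (use 6 in \<open>auto simp: cycle_product_def\<close>)
  qed
qed

text \<open>
  Passing from the symmetric to the alternating group only costs something for 5-cycles. Every other
  representative commutes with an odd permutation; a 5-cycle \<open>i \<mapsto> i + 1\<close> modulo 5 does not, but the odd
  permutation \<open>i \<mapsto> 2 i\<close> conjugates it to its square.
\<close>

lemma odd_conjugation_of_reps:
  assumes "q \<in> {id, rep22, rep3, rep33, rep24, rep5}"
  shows "\<exists>c q'. c permutes {1..6::nat} \<and> \<not> evenperm c \<and> q' \<in> {q, rep5 \<circ> rep5} \<and> c \<circ> q = q' \<circ> c"
proof -
  have tr: ?thesis if "transpose i j \<circ> q = q \<circ> transpose i j" "i \<in> {1..6}" "j \<in> {1..6}" "i \<noteq> j" for i j :: nat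
    using that by (intro exI[of _ "transpose i j"] exI[of _ q]) (simp add: permutes_swap_id evenperm_swap)
  consider "q = id" | "q = rep22" | "q = rep3" | "q = rep33" | "q = rep24" | "q = rep5"
    using assms by blast
  then show ?thesis
  proof cases
    case 1 show ?thesis by (rule tr[of 1 2]) (use 1 in auto)
  next
    case 2 show ?thesis by (rule tr[of 1 2]) (use 2 in \<open>simp_all, intro eq_on_six_points, simp_all add: transpose_def\<close>)
  next
    case 3 show ?thesis by (rule tr[of 4 5]) (use 3 in \<open>simp_all, intro eq_on_six_points, simp_all add: transpose_def\<close>)
  next
    case 4
    let ?c = "transpose 1 4 \<circ> transpose 2 5 \<circ> transpose 3 6 :: nat \<Rightarrow> nat"
    have "?c permutes {1..6}" by (intro permutes_compose permutes_swap_id) auto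
    moreover have "\<not> evenperm ?c"
      by (simp add: evenperm_comp evenperm_swap permutation_compose permutation_swap_id del: One_nat_def)
    moreover have "?c \<circ> q = q \<circ> ?c" unfolding 4 by (rule eq_on_six_points) (simp_all add: transpose_def)
    ultimately show ?thesis by blast
  next
    case 5 show ?thesis by (rule tr[of 1 2]) (use 5 in \<open>simp_all, intro eq_on_six_points, simp_all add: transpose_def\<close>)
  next
    case 6
    let ?c = "cycle_of_list [1,2,4,3] :: nat \<Rightarrow> nat"
    have "?c permutes {1..6}" using cycle_permutes[of "[1,2,4,3::nat]"] by (rule permutes_subset) auto
    moreover have "\<not> evenperm ?c" by (subst evenperm_cycle_of_list) auto
    moreover have "?c \<circ> q = (rep5 \<circ> rep5) \<circ> ?c" unfolding 6 by (rule eq_on_six_points) (simp_all add: transpose_def)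
    ultimately show ?thesis by blast
  qed
qed

lemma alt_group_6_conjugate:
  assumes "a \<in> carrier (alt_group 6)"
  obtains r q where "r \<in> carrier (alt_group 6)" "q \<in> {id, rep22, rep3, rep33, rep24, rep5, rep5 \<circ> rep5}"
    "r \<circ> a = q \<circ> r"
proof -
  obtain r q where r: "r permutes {1..6}" "q \<in> {id, rep22, rep3, rep33, rep24, rep5}" "r \<circ> a = q \<circ> r"
    using alt_group_6_sym_conjugate[OF assms] by blast
  show thesis
  proof (cases "evenperm r")
    case True
    then show ?thesis using that[of r q] r unfolding alt_group_carrier by blast
  next
    case False
    obtain c q' where c: "c permutes {1..6::nat}" "\<not> evenperm c" "q' \<in> {q, rep5 \<circ> rep5}" "c \<circ> q = q' \<circ> c"
      using odd_conjugation_of_reps[OF r(2)] by blast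
    have "evenperm (c \<circ> r)"
      using False c(1,2) r(1) by (subst evenperm_comp) (blast intro: permutes_imp_permutation[OF finite_atLeastAtMost])+
    moreover have "c \<circ> r permutes {1..6}" using r(1) c(1) by (rule permutes_compose)
    moreover have "(c \<circ> r) \<circ> a = q' \<circ> (c \<circ> r)" using r(3) c(4) by (metis comp_assoc)
    ultimately show ?thesis using that[of "c \<circ> r" q'] c(3) r(2) unfolding alt_group_carrier by blast
  qed
qed

lemma funpow_intertwine: "r \<circ> a = q \<circ> r \<Longrightarrow> r \<circ> (a ^^ n) = (q ^^ n) \<circ> r"
  by (induction n) (auto simp: fun_eq_iff)

lemma funpow_conj_eq_id_iff:
  assumes "bij r" "r \<circ> a = q \<circ> r" shows "a ^^ n = id \<longleftrightarrow> q ^^ n = id"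
proof -
  have "a ^^ n = id \<longleftrightarrow> r \<circ> (a ^^ n) = r"
    using bij_is_inj[OF assms(1)] by (auto simp: fun_eq_iff inj_eq)
  also have "\<dots> \<longleftrightarrow> (q ^^ n) \<circ> r = r" by (simp add: funpow_intertwine[OF assms(2)])
  also have "\<dots> \<longleftrightarrow> q ^^ n = id"
    using bij_is_surj[OF assms(1)] by (auto simp: fun_eq_iff) (metis surj_def)
  finally show ?thesis .
qed

lemma rep_orders:
  "rep22 ^^ 2 = id" "rep3 ^^ 3 = id" "rep33 ^^ 3 = id" "(rep24 ^^ 2) ^^ 2 = id" "rep5 ^^ 5 = id" "(rep5 \<circ> rep5) ^^ 5 = id"
proof -
  have root: "cycle_of_list cs ^^ n = id" if "distinct cs" "length cs = n" for cs :: "nat list" and n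
    using cycle_is_id_root[OF that(1)] that(2) by simp
  show "rep3 ^^ 3 = id" by (rule root) auto
  show r5: "rep5 ^^ 5 = id" by (rule root) auto
  have "(rep5 \<circ> rep5) ^^ 5 = (rep5 ^^ 2) ^^ 5" by (simp only: funpow_0 funpow.simps numeral_2_eq_2 comp_id)
  also have "\<dots> = (rep5 ^^ 5) ^^ 2" by (simp only: funpow_mult mult.commute)
  also have "\<dots> = id" unfolding r5 by simp
  finally show "(rep5 \<circ> rep5) ^^ 5 = id" .
  show "rep22 ^^ 2 = id" "rep33 ^^ 3 = id" "(rep24 ^^ 2) ^^ 2 = id"
    by (rule eq_on_six_points, simp_all add: numeral_2_eq_2 numeral_3_eq_3 transpose_def)+
qed

lemma moved_imp_neq_id: "q x \<noteq> x \<Longrightarrow> q \<noteq> id"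
  by auto

lemma rep_not_orders:
  "rep22 \<noteq> id" "rep5 \<noteq> id" "rep5 \<circ> rep5 \<noteq> id"
  "rep3 ^^ 2 \<noteq> id" "rep33 ^^ 2 \<noteq> id" "rep5 ^^ 2 \<noteq> id" "(rep5 \<circ> rep5) ^^ 2 \<noteq> id"
  "rep22 ^^ 3 \<noteq> id" "rep5 ^^ 3 \<noteq> id" "(rep5 \<circ> rep5) ^^ 3 \<noteq> id"
  "rep22 ^^ 5 \<noteq> id" "rep3 ^^ 5 \<noteq> id" "rep33 ^^ 5 \<noteq> id"
  "rep24 ^^ 2 \<noteq> id" "rep24 ^^ 3 \<noteq> id" "rep24 ^^ 5 \<noteq> id"
  by ((rule moved_imp_neq_id[of _ 1], simp add: eval_nat_numeral transpose_def; fail)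
    | (rule moved_imp_neq_id[of _ 3], simp add: eval_nat_numeral transpose_def; fail))+

lemma funpow_one: "f ^^ 1 = f" for f :: "'a \<Rightarrow> 'a"
  unfolding One_nat_def funpow.simps by (rule comp_id)

lemma alt_bij: "r \<in> carrier (alt_group n) \<Longrightarrow> bij r"
  unfolding alt_group_carrier using permutes_bij by blast

lemma alt_group_6_order_cases:
  assumes "a \<in> carrier (alt_group 6)" "a ^^ 3 \<noteq> id"
  shows "\<exists>m n. n \<in> {2, 5} \<and> a ^^ m \<noteq> id \<and> (a ^^ m) ^^ n = id"
proof -
  obtain r q where r: "r \<in> carrier (alt_group 6)" and ra: "r \<circ> a = q \<circ> r"
    and q: "q \<in> {id, rep22, rep3, rep33, rep24, rep5, rep5 \<circ> rep5}"
    using alt_group_6_conjugate[OF assms(1)] by metis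
  note iff = funpow_conj_eq_id_iff[OF alt_bij[OF r] ra]
  have "q ^^ 3 \<noteq> id" using assms(2) iff by blast
  then have "q \<in> {rep22, rep24, rep5, rep5 \<circ> rep5}" using q rep_orders(2,3) by auto
  then have "\<exists>m n. n \<in> {2, 5} \<and> q ^^ m \<noteq> id \<and> q ^^ (m * n) = id"
  proof (elim insertE emptyE)
    assume "q = rep22"
    then show ?thesis using rep_orders(1) rep_not_orders(1)
      by (intro exI[of _ 1] exI[of _ 2]) (simp only: funpow_one mult_1, blast)
  next
    assume "q = rep24"
    then show ?thesis using rep_orders(4) rep_not_orders(14)
      by (intro exI[of _ 2]) (simp only: funpow_mult mult.commute, blast)
  next
    assume "q = rep5"
    then show ?thesis using rep_orders(5) rep_not_orders(2)
      by (intro exI[of _ 1] exI[of _ 5]) (simp only: funpow_one mult_1, blast)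
  next
    assume "q = rep5 \<circ> rep5"
    then show ?thesis using rep_orders(6) rep_not_orders(3)
      by (intro exI[of _ 1] exI[of _ 5]) (simp only: funpow_one mult_1, blast)
  qed
  then show ?thesis by (simp only: funpow_mult iff mult.commute)
qed

lemma alt_group_6_order_three:
  assumes "a \<in> carrier (alt_group 6)" "a ^^ 3 = id" "a \<noteq> id"
  obtains r q where "r \<in> carrier (alt_group 6)" "q \<in> {rep3, rep33}" "r \<circ> a = q \<circ> r"
proof -
  obtain r q where r: "r \<in> carrier (alt_group 6)" and ra: "r \<circ> a = q \<circ> r"
    and q: "q \<in> {id, rep22, rep3, rep33, rep24, rep5, rep5 \<circ> rep5}"
    using alt_group_6_conjugate[OF assms(1)] by metis
  note iff = funpow_conj_eq_id_iff[OF alt_bij[OF r] ra]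
  have "q ^^ 3 = id" "q \<noteq> id"
    using assms(2,3) iff[of 3] iff[of 1] unfolding funpow_one by blast+
  then have "q \<in> {rep3, rep33}" using q rep_not_orders(8,15,9,10) by auto
  then show thesis using that[OF r _ ra] by blast
qed

text \<open>
  For order 5 the two classes represented by \<open>rep5\<close> and \<open>rep5 \<circ> rep5\<close> are merged by taking powers,
  since the cube of the square is the element itself.
\<close>

lemma alt_group_6_prime_order_rep:
  assumes "n \<in> {2, 5}"
  shows "\<exists>e. \<forall>b \<in> carrier (alt_group 6). b \<noteq> id \<longrightarrow> b ^^ n = id \<longrightarrow>
      (\<exists>r\<in>carrier (alt_group 6). \<exists>k. r \<circ> b ^^ k = e \<circ> r) \<and> (\<exists>r\<in>carrier (alt_group 6). \<exists>k. r \<circ> b = e ^^ k \<circ> r)"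
proof -
  have main: ?thesis
    if e: "\<And>q. q \<in> {id, rep22, rep3, rep33, rep24, rep5, rep5 \<circ> rep5} \<Longrightarrow> q \<noteq> id \<Longrightarrow> q ^^ n = id \<Longrightarrow>
      (\<exists>k. q ^^ k = e) \<and> (\<exists>k. q = e ^^ k)" for e
  proof (intro exI[of _ e] ballI impI)
    fix b assume b: "b \<in> carrier (alt_group 6)" "b \<noteq> id" "b ^^ n = id"
    obtain r q where r: "r \<in> carrier (alt_group 6)" and ra: "r \<circ> b = q \<circ> r"
      and q: "q \<in> {id, rep22, rep3, rep33, rep24, rep5, rep5 \<circ> rep5}"
      using alt_group_6_conjugate[OF b(1)] by metis
    note iff = funpow_conj_eq_id_iff[OF alt_bij[OF r] ra]
    have "q ^^ n = id" "q \<noteq> id"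
      using b(2,3) iff[of n] iff[of 1] unfolding funpow_one by blast+
    then obtain k k' where "q ^^ k = e" "q = e ^^ k'" using e[OF q] by metis
    then show "(\<exists>r\<in>carrier (alt_group 6). \<exists>k. r \<circ> b ^^ k = e \<circ> r) \<and>
               (\<exists>r\<in>carrier (alt_group 6). \<exists>k. r \<circ> b = e ^^ k \<circ> r)"
      using r ra funpow_intertwine[OF ra, of k] by metis
  qed
  show ?thesis
  proof (cases "n = 2")
    case True
    show ?thesis
    proof (rule main[of rep22])
      fix q assume "q \<in> {id, rep22, rep3, rep33, rep24, rep5, rep5 \<circ> rep5}" "q \<noteq> id" "q ^^ n = id"
      then have "q = rep22" using rep_not_orders(4-7,14) unfolding True by blast
      then show "(\<exists>k. q ^^ k = rep22) \<and> (\<exists>k. q = rep22 ^^ k)" by (metis funpow_one)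
    qed
  next
    case False
    then have n: "n = 5" using assms by blast
    have six: "(rep5 \<circ> rep5) ^^ 3 = rep5"
    proof -
      have "(rep5 \<circ> rep5) ^^ 3 = rep5 ^^ Suc 5"
        by (simp only: numeral_3_eq_3 eval_nat_numeral funpow.simps comp_id o_assoc BitM.simps)
      then show ?thesis unfolding funpow.simps rep_orders(5) comp_id .
    qed
    show ?thesis
    proof (rule main[of rep5])
      fix q assume "q \<in> {id, rep22, rep3, rep33, rep24, rep5, rep5 \<circ> rep5}" "q \<noteq> id" "q ^^ n = id"
      then have "q = rep5 \<or> q = rep5 \<circ> rep5" using rep_not_orders(11-13,16) unfolding n by blast
      moreover have "rep5 \<circ> rep5 = rep5 ^^ 2" by (simp only: numeral_2_eq_2 funpow.simps comp_id)
      ultimately show "(\<exists>k. q ^^ k = rep5) \<and> (\<exists>k. q = rep5 ^^ k)" using six by (metis funpow_one)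
    qed
  qed
qed

lemma alt_group_6_conjugate_to_power:
  assumes "n \<in> {2, 5}" "b \<in> carrier (alt_group 6)" "b \<noteq> id" "b ^^ n = id"
    and "b' \<in> carrier (alt_group 6)" "b' \<noteq> id" "b' ^^ n = id"
  obtains h k where "h \<in> carrier (alt_group 6)" "b' = h \<circ> b ^^ k \<circ> inv' h"
proof -
  obtain e where e: "\<And>b. b \<in> carrier (alt_group 6) \<Longrightarrow> b \<noteq> id \<Longrightarrow> b ^^ n = id \<Longrightarrow>
      (\<exists>r\<in>carrier (alt_group 6). \<exists>k. r \<circ> b ^^ k = e \<circ> r) \<and> (\<exists>r\<in>carrier (alt_group 6). \<exists>k. r \<circ> b = e ^^ k \<circ> r)"
    using alt_group_6_prime_order_rep[OF assms(1)] by blast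
  obtain r k where r: "r \<in> carrier (alt_group 6)" "r \<circ> b ^^ k = e \<circ> r" using e[OF assms(2-4)] by blast
  obtain s l where s: "s \<in> carrier (alt_group 6)" "s \<circ> b' = e ^^ l \<circ> s" using e[OF assms(5-7)] by blast
  have br: "bij r" and bs: "bij s" using r(1) s(1) alt_bij by blast+
  have "b' = inv' s \<circ> (s \<circ> b')" using bs by (simp add: o_assoc bij_is_inj)
  also have "\<dots> = inv' s \<circ> (e ^^ l \<circ> r) \<circ> (inv' r \<circ> s)"
    unfolding s(2) using br by (auto simp: fun_eq_iff bij_is_surj surj_f_inv_f)
  also have "e ^^ l \<circ> r = r \<circ> b ^^ (k * l)"
    using funpow_intertwine[OF r(2), of l] by (simp add: funpow_mult)
  also have "inv' s \<circ> (r \<circ> b ^^ (k * l)) \<circ> (inv' r \<circ> s) = (inv' s \<circ> r) \<circ> b ^^ (k * l) \<circ> inv' (inv' s \<circ> r)"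
    using br bs by (simp add: o_inv_distrib bij_imp_bij_inv inv_inv_eq o_assoc)
  finally show thesis
    using that[of "inv' s \<circ> r"] alt_comp[OF alt_group_inv_closed[OF s(1)] r(1)] by blast
qed

section \<open>The exotic involution\<close>

text \<open>
  Residues modulo 5, with representatives 1 to 5. The six points are read as the projective line over
  the field with five elements, 6 being the point at infinity.
\<close>

definition res5 :: "nat \<Rightarrow> nat" where
  "res5 m = (if m mod 5 = 0 then 5 else m mod 5)"

definition triple_transposition :: "nat \<Rightarrow> nat \<Rightarrow> nat \<Rightarrow> nat \<Rightarrow> nat \<Rightarrow> nat \<Rightarrow> nat \<Rightarrow> nat" where
  "triple_transposition a b c d e f = transpose a b \<circ> transpose c d \<circ> transpose e f"

text \<open>
  A syntheme is a partition of the six points into three pairs, here regarded as a fixed-point-free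
  involution. The symmetric group of degree six has an outer automorphism because the 15 pairs and the
  15 synthemes form a self-dual incidence structure, the generalised quadrangle of order \<open>(2, 2)\<close>.
  The formula below is a polarity of it: a bijection from pairs \<open>{i, j}\<close> to synthemes such that
  \<open>{x, y}\<close> belongs to the syntheme of \<open>{i, j}\<close> iff \<open>{i, j}\<close> belongs to the syntheme of \<open>{x, y}\<close>.
  In coordinates, the syntheme of \<open>{\<infinity>, i}\<close> is \<open>{\<infinity>, i}, {i + 1, i - 1}, {i + 2, i - 2}\<close>, and that of
  \<open>{i, j}\<close> is \<open>{\<infinity>, (i + j) / 2}, {i, 2 i - j}, {j, 2 j - i}\<close>; negative coefficients and the division
  are replaced by their residues modulo 5.
\<close>

definition syntheme :: "nat \<Rightarrow> nat \<Rightarrow> nat \<Rightarrow> nat" where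
  "syntheme i j =
     (if i = 6 then triple_transposition 6 j (res5 (j + 1)) (res5 (j + 4)) (res5 (j + 2)) (res5 (j + 3))
      else if j = 6 then triple_transposition 6 i (res5 (i + 1)) (res5 (i + 4)) (res5 (i + 2)) (res5 (i + 3))
      else triple_transposition 6 (res5 (3 * (i + j))) i (res5 (2 * i + 4 * j)) j (res5 (4 * i + 2 * j)))"

definition points :: "nat list" where "points = [1,2,3,4,5,6]"

lemma set_points: "set points = {1..6}" by (auto simp: points_def)

text \<open>
  This finite check and the next two are phrased with conditionals, which the rewriting
  evaluates lazily. It verifies that the formula yields involutions without fixed points and
  is a polarity.
\<close>

lemma syntheme_duality_points:
  "\<forall>i\<in>set points. \<forall>j\<in>set points. \<forall>x\<in>set points. if i = j then True else
      syntheme i j x \<in> set points \<and> syntheme i j x \<noteq> x \<and> syntheme x (syntheme i j x) i = j"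
  by code_simp

text \<open>
  The transposition \<open>(6 b)\<close> of points acts on synthemes as the syntheme of \<open>{6, b}\<close>
  acts on pairs. Transpositions moving 6 suffice, because they generate the symmetric group.
\<close>

lemma syntheme_equivariant_points:
  "\<forall>b\<in>set [1,2,3,4,5]. \<forall>i\<in>set points. \<forall>j\<in>set points. if i = j then True else \<forall>x\<in>set points.
      syntheme (syntheme 6 b i) (syntheme 6 b j) (transpose 6 b x) = transpose 6 b (syntheme i j x)"
  by code_simp

text \<open>
  Two synthemes can agree at \<open>x\<close> and differ at any prescribed other point \<open>y\<close>; the witnesses are the
  synthemes of two pairs taken from the syntheme of \<open>{x, z}\<close>: by duality both contain \<open>{x, z}\<close>.
\<close>

lemma syntheme_separates_points:
  "\<forall>x\<in>set points. \<forall>y\<in>set points. if x = y then True else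
     \<exists>z\<in>set points. if x = z then False else 
       \<exists>v\<in>set points. syntheme 6 (syntheme x z 6) y \<noteq> syntheme v (syntheme x z v) y"
  by code_simp

text \<open>
  Three disjoint transpositions, hence an odd permutation.
\<close>

lemma syntheme_odd_points:
  "\<forall>b\<in>set [1,2,3,4,5]. distinct [6, b, res5 (b + 1), res5 (b + 4), res5 (b + 2), res5 (b + 3)] \<and>
      set [6, b, res5 (b + 1), res5 (b + 4), res5 (b + 2), res5 (b + 3)] \<subseteq> set points"
  by code_simp

lemma syntheme_in: "i \<in> {1..6} \<Longrightarrow> j \<in> {1..6} \<Longrightarrow> x \<in> {1..6} \<Longrightarrow> i \<noteq> j \<Longrightarrow> syntheme i j x \<in> {1..6}"
  and syntheme_neq: "i \<in> {1..6} \<Longrightarrow> j \<in> {1..6} \<Longrightarrow> x \<in> {1..6} \<Longrightarrow> i \<noteq> j \<Longrightarrow> syntheme i j x \<noteq> x"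
  and syntheme_duality: "i \<in> {1..6} \<Longrightarrow> j \<in> {1..6} \<Longrightarrow> x \<in> {1..6} \<Longrightarrow> i \<noteq> j \<Longrightarrow>
        syntheme x (syntheme i j x) i = j"
  using syntheme_duality_points unfolding set_points by metis+

text \<open>
  The graph of the outer automorphism: \<open>q\<close> acts on pairs as \<open>p\<close> acts on synthemes. Keeping it a
  relation makes the automorphism involutory for free, since the polarity makes the relation symmetric.
  Equal parity is recorded so that the automorphism restricts to the alternating group.
\<close>

definition dual_pair :: "(nat \<Rightarrow> nat) \<Rightarrow> (nat \<Rightarrow> nat) \<Rightarrow> bool" where
  "dual_pair p q \<longleftrightarrow> p permutes {1..6} \<and> q permutes {1..6} \<and> evenperm p = evenperm q \<and>
     (\<forall>i\<in>{1..6}. \<forall>j\<in>{1..6}. \<forall>x\<in>{1..6}. i \<noteq> j \<longrightarrow> syntheme (q i) (q j) (p x) = p (syntheme i j x))"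

lemma dual_pairD:
  assumes "dual_pair p q"
  shows "p permutes {1..6}" "q permutes {1..6}" "evenperm p = evenperm q"
    "\<And>i j x. i \<in> {1..6} \<Longrightarrow> j \<in> {1..6} \<Longrightarrow> x \<in> {1..6} \<Longrightarrow> i \<noteq> j \<Longrightarrow>
       syntheme (q i) (q j) (p x) = p (syntheme i j x)"
  using assms unfolding dual_pair_def by blast+

lemma dual_pair_sym: assumes "dual_pair p q" shows "dual_pair q p"
proof -
  note p = dual_pairD(1)[OF assms] and q = dual_pairD(2)[OF assms]
  have "syntheme (p i) (p j) (q x) = q (syntheme i j x)" if "i \<in> {1..6}" "j \<in> {1..6}" "x \<in> {1..6}" "i \<noteq> j" for i j x
  proof -
    define y where "y = syntheme i j x"
    have y: "y \<in> {1..6}" "x \<noteq> y" "syntheme x y i = j"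
      using syntheme_in[OF that] syntheme_neq[OF that] syntheme_duality[OF that] by (auto simp: y_def)
    have "syntheme (q x) (q y) (p i) = p (syntheme x y i)"
      by (rule dual_pairD(4)[OF assms that(3) y(1) that(1) y(2)])
    then have "syntheme (q x) (q y) (p i) = p j" by (simp add: y(3))
    moreover have "q x \<noteq> q y" using y(2) permutes_inj[OF q] by (auto dest: injD)
    ultimately show ?thesis
      using syntheme_duality[of "q x" "q y" "p i"] that y(1)
        permutes_in_image[OF p] permutes_in_image[OF q] unfolding y_def[symmetric] by metis
  qed
  then show ?thesis using p q dual_pairD(3)[OF assms] unfolding dual_pair_def by blast
qed

lemma dual_pair_comp: assumes "dual_pair p q" "dual_pair p' q'" shows "dual_pair (p \<circ> p') (q \<circ> q')"
proof -
  note * = dual_pairD(1,2)[OF assms(1)] dual_pairD(1,2)[OF assms(2)]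
  have "syntheme (q (q' i)) (q (q' j)) (p (p' x)) = p (p' (syntheme i j x))"
    if "i \<in> {1..6}" "j \<in> {1..6}" "x \<in> {1..6}" "i \<noteq> j" for i j x
  proof -
    have "q' i \<in> {1..6}" "q' j \<in> {1..6}" "p' x \<in> {1..6}" "q' i \<noteq> q' j"
      using that permutes_in_image[OF *(3)] permutes_in_image[OF *(4)] inj_eq[OF permutes_inj[OF *(4)]]
      by blast+
    then have "syntheme (q (q' i)) (q (q' j)) (p (p' x)) = p (syntheme (q' i) (q' j) (p' x))"
      by (rule dual_pairD(4)[OF assms(1)])
    also have "syntheme (q' i) (q' j) (p' x) = p' (syntheme i j x)"
      by (rule dual_pairD(4)[OF assms(2) that])
    finally show ?thesis .
  qed
  moreover have "evenperm (p \<circ> p') = evenperm (q \<circ> q')"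
    using assms[THEN dual_pairD(3)] *[THEN permutes_imp_permutation[OF finite_atLeastAtMost]]
    by (simp add: evenperm_comp)
  ultimately show ?thesis using * permutes_compose unfolding dual_pair_def o_apply by blast
qed

lemma dual_pair_id: "dual_pair id id" by (simp add: dual_pair_def permutes_id)

lemma dual_pair_star_transposition:
  assumes "b \<in> {1..5}"
  shows "dual_pair (transpose 6 b) (syntheme 6 b)"
proof -
  have b: "b \<in> set [1,2,3,4,5]" using assms by auto
  let ?l = "[6, b, res5 (b + 1), res5 (b + 4), res5 (b + 2), res5 (b + 3)]"
  have d: "distinct ?l" "set ?l \<subseteq> {1..6}"
    using syntheme_odd_points b unfolding set_points by blast+
  have s: "syntheme 6 b = transpose 6 b \<circ> transpose (res5 (b + 1)) (res5 (b + 4)) \<circ> transpose (res5 (b + 2)) (res5 (b + 3))"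
    by (simp add: syntheme_def triple_transposition_def)
  have "syntheme 6 b permutes {1..6}"
    unfolding s using d(2) by (intro permutes_compose permutes_swap_id) auto
  moreover have "\<not> evenperm (syntheme 6 b)"
    unfolding s using d(1)
    by (simp add: evenperm_comp evenperm_swap permutation_compose permutation_swap_id del: One_nat_def)
  moreover have "transpose 6 b permutes {1..6}" "\<not> evenperm (transpose 6 b)"
    using assms by (auto intro: permutes_swap_id simp: evenperm_swap)
  moreover have "syntheme (syntheme 6 b i) (syntheme 6 b j) (transpose 6 b x) = transpose 6 b (syntheme i j x)"
    if "i \<in> {1..6}" "j \<in> {1..6}" "x \<in> {1..6}" "i \<noteq> j" for i j x
    using syntheme_equivariant_points b that unfolding set_points by metis
  ultimately show ?thesis by (simp add: dual_pair_def)
qed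

lemma ex_dual_pair: assumes "p permutes {1..6}" shows "\<exists>q. dual_pair p q"
proof -
  have star: "\<exists>q. dual_pair (transpose 6 b) q" if "b \<in> {1..6}" for b
    using that dual_pair_star_transposition[of b] dual_pair_id by (cases "b = 6") (auto simp: transpose_same)
  have tr: "\<exists>q. dual_pair (transpose a b) q" if "a \<in> {1..6}" "b \<in> {1..6}" "a \<noteq> b" for a b :: nat
  proof (cases "a = 6 \<or> b = 6")
    case True
    then show ?thesis using star that by (metis transpose_commute)
  next
    case False
    then have "transpose a b = transpose 6 a \<circ> (transpose 6 b \<circ> transpose 6 a)"
      using that(3) by (auto simp: fun_eq_iff transpose_def)
    then show ?thesis using star that dual_pair_comp by metis
  qed
  show ?thesis
    using assms finite_atLeastAtMost[of 1 "6::nat"]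
  proof (induction rule: permutes_induct)
    case id
    show ?case using dual_pair_id by (auto simp: id_def)
  next
    case (swap a b p)
    then show ?case using tr dual_pair_comp by blast
  qed
qed

text \<open>
  Both \<open>q\<close> and \<open>q'\<close> intertwine the same actions on synthemes, so if \<open>q' x = q y\<close> with \<open>y \<noteq> x\<close>, synthemes
  that agree at \<open>x\<close> would also agree at \<open>y\<close>.
\<close>

lemma dual_pair_unique: assumes "dual_pair p q" "dual_pair p q'" shows "q' = q"
proof (rule ccontr)
  assume "q' \<noteq> q"
  then obtain x where x: "q' x \<noteq> q x" by auto
  note q = dual_pairD(2)[OF assms(1)] and q' = dual_pairD(2)[OF assms(2)]
  have x6: "x \<in> {1..6}" using x q q' by (metis permutes_not_in)
  then obtain y where y: "y \<in> {1..6}" "q y = q' x" using permutes_inverses(1)[OF q]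
    permutes_in_image[OF permutes_inv[OF q]] permutes_in_image[OF q'] by metis
  have sep: "q' (syntheme i j x) = q (syntheme i j y)" if "i \<in> {1..6}" "j \<in> {1..6}" "i \<noteq> j" for i j
  proof -
    have "syntheme (p i) (p j) (q' x) = q' (syntheme i j x)"
      by (rule dual_pairD(4)[OF dual_pair_sym[OF assms(2)] that(1,2) x6 that(3)])
    moreover have "syntheme (p i) (p j) (q y) = q (syntheme i j y)"
      by (rule dual_pairD(4)[OF dual_pair_sym[OF assms(1)] that(1,2) y(1) that(3)])
    ultimately show ?thesis using y(2) by simp
  qed
  have "x \<noteq> y" using x y by auto
  then obtain z v where z: "z \<in> {1..6}" "x \<noteq> z" and v: "v \<in> {1..6}"
    and ne: "syntheme 6 (syntheme x z 6) y \<noteq> syntheme v (syntheme x z v) y"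
    using syntheme_separates_points x6 y(1) unfolding set_points by metis
  have "syntheme w (syntheme x z w) x = z" if "w \<in> {1..6}" for w
    using syntheme_duality[OF x6 z(1) that z(2)] .
  moreover have "syntheme x z w \<in> {1..6} \<and> syntheme x z w \<noteq> w" if "w \<in> {1..6}" for w
    using syntheme_in[OF x6 z(1) that z(2)] syntheme_neq[OF x6 z(1) that z(2)] by blast
  ultimately have "q (syntheme w (syntheme x z w) y) = q' z" if "w \<in> {1..6}" for w
    using sep[of w "syntheme x z w"] that by metis
  then have "q (syntheme 6 (syntheme x z 6) y) = q (syntheme v (syntheme x z v) y)"
    using v by simp
  then show False using ne permutes_inj[OF q] by (auto dest: injD)
qed

definition exotic :: "(nat \<Rightarrow> nat) \<Rightarrow> (nat \<Rightarrow> nat)" where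
  "exotic = (\<lambda>p\<in>carrier (alt_group 6). THE q. dual_pair p q)"

lemma exotic_eqI: assumes "evenperm p" "dual_pair p q" shows "exotic p = q"
proof -
  have "p \<in> carrier (alt_group 6)" using assms by (simp add: alt_group_carrier dual_pair_def)
  then show ?thesis using assms(2) dual_pair_unique by (auto simp: exotic_def intro!: the_equality)
qed

lemma dual_pair_exotic: assumes "p \<in> carrier (alt_group 6)" shows "dual_pair p (exotic p)"
  using assms ex_dual_pair[of p] exotic_eqI[of p] by (auto simp: alt_group_carrier)

lemma exotic_closed: "p \<in> carrier (alt_group 6) \<Longrightarrow> exotic p \<in> carrier (alt_group 6)"
  using dual_pair_exotic by (auto simp: dual_pair_def alt_group_carrier)

lemma exotic_exotic: assumes "p \<in> carrier (alt_group 6)" shows "exotic (exotic p) = p"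
  using exotic_eqI[OF _ dual_pair_sym[OF dual_pair_exotic[OF assms]]] exotic_closed[OF assms]
  by (auto simp: alt_group_carrier)

lemma exotic_comp:
  assumes "p \<in> carrier (alt_group 6)" "q \<in> carrier (alt_group 6)"
  shows "exotic (p \<circ> q) = exotic p \<circ> exotic q"
proof (rule exotic_eqI)
  show "dual_pair (p \<circ> q) (exotic p \<circ> exotic q)"
    using assms by (intro dual_pair_comp dual_pair_exotic)
  show "evenperm (p \<circ> q)"
    using assms evenperm_comp[of p q] by (simp add: alt_group_carrier' ) (simp add: alt_group_carrier)
qed

lemma exotic_in_auto: "exotic \<in> auto (alt_group 6)"
proof -
  have "bij_betw exotic (carrier (alt_group 6)) (carrier (alt_group 6))"
    by (rule bij_betw_byWitness[of _ exotic]) (auto simp: exotic_exotic exotic_closed)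
  moreover have "exotic \<in> extensional (carrier (alt_group 6))" by (simp add: exotic_def)
  ultimately show ?thesis
    by (auto simp: auto_def hom_def Bij_def exotic_closed exotic_comp alt_group_mult)
qed

lemma exotic_order_two:
  "compose (carrier (alt_group 6)) exotic exotic = (\<lambda>p\<in>carrier (alt_group 6). p)"
  by (auto simp: compose_def exotic_exotic)

section \<open>Every automorphism is a conjugation, up to the exotic involution\<close>

definition conj_aut :: "(nat \<Rightarrow> nat) \<Rightarrow> (nat \<Rightarrow> nat) \<Rightarrow> (nat \<Rightarrow> nat)" where
  "conj_aut p = (\<lambda>x\<in>carrier (alt_group 6). p \<circ> x \<circ> inv' p)"

lemma conj_closed:
  assumes "p permutes {1..6}" "x \<in> carrier (alt_group 6)"
  shows "p \<circ> x \<circ> inv' p \<in> carrier (alt_group 6)"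
proof -
  have x: "x permutes {1..6}" "evenperm x" using assms(2) unfolding alt_group_carrier by blast+
  note perm = permutes_imp_permutation[OF finite_atLeastAtMost]
  note p = assms(1) permutes_inv[OF assms(1)]
  have "p \<circ> x \<circ> inv' p permutes {1..6}" by (intro permutes_compose p x)
  moreover have "evenperm (p \<circ> x \<circ> inv' p)"
    using p x perm[OF p(1)] perm[OF p(2)] perm[OF x(1)]
    by (simp add: evenperm_comp permutation_compose evenperm_inv)
  ultimately show ?thesis unfolding alt_group_carrier by blast
qed

lemma conj_aut_comp:
  assumes "p permutes {1..6}" "q permutes {1..6}"
  shows "compose (carrier (alt_group 6)) (conj_aut p) (conj_aut q) = conj_aut (p \<circ> q)"
  using assms
  by (auto simp: compose_def conj_aut_def conj_closed fun_eq_iff o_inv_distrib permutes_bij)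

lemma conj_aut_id: "conj_aut id = (\<lambda>x\<in>carrier (alt_group 6). x)"
  by (simp add: conj_aut_def)

lemma conj_aut_in_auto: assumes "p permutes {1..6}" shows "conj_aut p \<in> auto (alt_group 6)"
proof -
  let ?A = "carrier (alt_group 6)"
  have ip: "inv' p permutes {1..6}" using assms by (rule permutes_inv)
  have inv1: "conj_aut (inv' p) (conj_aut p x) = x" if "x \<in> ?A" for x
    using that conj_aut_comp[OF ip assms] permutes_inv_o(2)[OF assms]
    by (metis compose_eq conj_aut_id restrict_apply')
  have inv2: "conj_aut p (conj_aut (inv' p) x) = x" if "x \<in> ?A" for x
    using that conj_aut_comp[OF assms ip] permutes_inv_o(1)[OF assms]
    by (metis compose_eq conj_aut_id restrict_apply')
  have "bij_betw (conj_aut p) ?A ?A"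
    by (rule bij_betw_byWitness[of _ "conj_aut (inv' p)"])
      (use assms ip conj_closed inv1 inv2 in \<open>auto simp: conj_aut_def\<close>)
  moreover have "conj_aut p (x \<circ> y) = conj_aut p x \<circ> conj_aut p y" if "x \<in> ?A" "y \<in> ?A" for x y
    using that alt_comp[OF that] permutes_inverses(2)[OF assms] by (simp add: conj_aut_def fun_eq_iff)
  moreover have "conj_aut p x \<in> ?A" if "x \<in> ?A" for x
    using that conj_closed[OF assms] by (simp add: conj_aut_def)
  moreover have "conj_aut p \<in> extensional ?A" by (simp add: conj_aut_def)
  ultimately show ?thesis by (auto simp: auto_def hom_def Bij_def alt_group_mult)
qed

lemma inner_automorphisms_alt_group_6:
  "inner_automorphisms (alt_group 6) = conj_aut ` carrier (alt_group 6)"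
  unfolding inner_automorphisms_def conj_aut_def alt_group_mult
  by (intro image_cong refl) (simp add: alt_group_inv_equality)

lemma auto_alt_groupD:
  assumes "\<beta> \<in> auto (alt_group n)"
  shows "x \<in> carrier (alt_group n) \<Longrightarrow> \<beta> x \<in> carrier (alt_group n)"
    and "x \<in> carrier (alt_group n) \<Longrightarrow> y \<in> carrier (alt_group n) \<Longrightarrow> \<beta> (x \<circ> y) = \<beta> x \<circ> \<beta> y"
    and "\<beta> id = id"
    and "x \<in> carrier (alt_group n) \<Longrightarrow> y \<in> carrier (alt_group n) \<Longrightarrow> \<beta> x = \<beta> y \<Longrightarrow> x = y"
    and "x \<in> carrier (alt_group n) \<Longrightarrow> \<beta> (x ^^ k) = \<beta> x ^^ k"
    and "x \<in> carrier (alt_group n) \<Longrightarrow> \<beta> (inv' x) = inv' (\<beta> x)"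
    and "\<beta> \<in> extensional (carrier (alt_group n))"
proof -
  interpret h: group_hom "alt_group n" "alt_group n" \<beta>
    using assms alt_group_is_group by (simp add: group_hom_def group_hom_axioms_def auto_def)
  show c: "\<beta> x \<in> carrier (alt_group n)" if "x \<in> carrier (alt_group n)" for x using that by simp
  show m: "\<beta> (x \<circ> y) = \<beta> x \<circ> \<beta> y" if "x \<in> carrier (alt_group n)" "y \<in> carrier (alt_group n)" for x y
    using h.hom_mult[OF that] by (simp add: alt_group_mult)
  show i: "\<beta> id = id" using h.hom_one by (simp add: alt_group_one)
  show "x = y" if "x \<in> carrier (alt_group n)" "y \<in> carrier (alt_group n)" "\<beta> x = \<beta> y"
    using assms that by (auto simp: auto_def Bij_def bij_betw_def dest: inj_onD)
  have pow: "x ^^ k \<in> carrier (alt_group n) \<and> \<beta> (x ^^ k) = \<beta> x ^^ k" if "x \<in> carrier (alt_group n)" for x k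
  proof (induction k)
    case 0
    show ?case using i monoid.one_closed[OF group.is_monoid[OF alt_group_is_group[of n]]] unfolding alt_group_one funpow.simps by blast
  next
    case (Suc k)
    then show ?case
      using m[OF that, of "x ^^ k"] alt_comp[OF that, of "x ^^ k"] unfolding funpow.simps by metis
  qed
  then show "\<beta> (x ^^ k) = \<beta> x ^^ k" if "x \<in> carrier (alt_group n)" using that by blast
  show "\<beta> (inv' x) = inv' (\<beta> x)" if "x \<in> carrier (alt_group n)"
    using h.hom_inv[OF that] alt_group_inv_equality[OF that] alt_group_inv_equality[OF c[OF that]] by simp
  show "\<beta> \<in> extensional (carrier (alt_group n))" using assms by (simp add: auto_def Bij_def)
qed

lemma three_cycles_conj:
  assumes "x \<in> three_cycles 6" "h permutes {1..6}"
  shows "h \<circ> x \<circ> inv' h \<in> three_cycles 6"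
proof -
  obtain cs where cs: "x = cycle_of_list cs" "distinct cs" "length cs = 3" "set cs \<subseteq> {1..6}"
    using assms(1) by blast
  have "h \<circ> x \<circ> inv' h = cycle_of_list (map h cs)"
    unfolding cs(1) by (rule conjugation_of_cycle[OF cs(2) permutes_bij[OF assms(2)]])
  moreover have "distinct (map h cs)"
    using cs(2) inj_on_subset[OF permutes_inj[OF assms(2)]] by (simp add: distinct_map)
  moreover have "set (map h cs) \<subseteq> {1..6}" using cs(4) permutes_image[OF assms(2)] by auto
  ultimately show ?thesis using cs(3) by (intro CollectI exI[of _ "map h cs"]) simp
qed

lemma three_cycleI: "distinct [a,b,c] \<Longrightarrow> {a,b,c} \<subseteq> {1..n} \<Longrightarrow> cycle_of_list [a,b,c] \<in> three_cycles n"
  by (intro CollectI exI[of _ "[a,b,c]"]) auto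

lemma three_cycle_rotate:
  assumes "distinct [a,b,c]" shows "cycle_of_list [a,b,c] = cycle_of_list [b,c,a]"
  using cycle_of_list_rotate_independent[OF assms, of 1] by simp

lemma three_cycle_apply:
  assumes "distinct [a,b,c]"
  shows "cycle_of_list [a,b,c] a = b" "cycle_of_list [a,b,c] b = c" "cycle_of_list [a,b,c] c = a"
    "x \<notin> {a,b,c} \<Longrightarrow> cycle_of_list [a,b,c] x = x"
  using assms by (auto simp: transpose_def)

lemma three_cycle_inj: "cycle_of_list cs x = cycle_of_list cs y \<longleftrightarrow> x = y"
  using permutation_bijective[OF permutation_of_cycle[of cs]] by (simp add: bij_is_inj inj_eq)

text \<open>
  Conjugating \<open>(1 2 i)\<close> by \<open>(1 2 j)\<close> and by its inverse replaces one of the points 1 and 2 by \<open>j\<close>; a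
  second conjugation removes the other one.
\<close>

lemma star_three_cycles_generate:
  assumes D: "subgroup D (alt_group 6)"
    and star: "\<And>k. k \<in> {3..6} \<Longrightarrow> cycle_of_list [1,2,k] \<in> D"
  shows "D = carrier (alt_group 6)"
proof -
  interpret A: group "alt_group 6" by (rule alt_group_is_group)
  interpret D: subgroup D "alt_group 6" by (rule D)
  define C where "C x y z \<longleftrightarrow> cycle_of_list [x,y,z] \<in> D" for x y z
  have rot: "C x y z \<longleftrightarrow> C y z x" if "distinct [x,y,z]" for x y z
    unfolding C_def three_cycle_rotate[OF that] ..
  have inv: "C y x z" if "C x y z" "distinct [x,y,z]" for x y z
  proof -
    have "cycle_of_list [y,x,z] = cycle_of_list [x,y,z] \<circ> cycle_of_list [x,y,z]"
      using that(2) by (auto simp: fun_eq_iff transpose_def)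
    then show ?thesis using D.m_closed that(1) unfolding C_def alt_group_mult by metis
  qed
  have conj: "C x' y' z'" if "C x y z" "C a b c" "distinct [x,y,z]"
    "cycle_of_list [a,b,c] x = x'" "cycle_of_list [a,b,c] y = y'" "cycle_of_list [a,b,c] z = z'"
    for x y z x' y' z' a b c
  proof -
    let ?u = "cycle_of_list [a,b,c]"
    have u: "?u \<in> D" using that(2) unfolding C_def .
    then have "?u \<circ> cycle_of_list [x,y,z] \<circ> inv' ?u \<in> D"
      using D.m_closed[OF D.m_closed[OF u that(1)[unfolded C_def]] D.m_inv_closed[OF u]]
        alt_group_inv_equality[OF D.mem_carrier[OF u]] unfolding alt_group_mult by metis
    moreover have "bij ?u" using D.mem_carrier[OF u] by (rule alt_bij)
    ultimately have "cycle_of_list (map ?u [x,y,z]) \<in> D"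
      using conjugation_of_cycle[OF that(3)] by metis
    then show ?thesis unfolding C_def list.map that(4-6) .
  qed
  have T1: "C 1 2 i" if "i \<in> {3..6}" for i using star[OF that] unfolding C_def .
  have T2: "C 2 1 i" if "i \<in> {3..6}" for i using inv[OF T1[OF that]] that by auto
  have T3: "C 2 j i" if "i \<in> {3..6}" "j \<in> {3..6}" "i \<noteq> j" for i j
    by (rule conj[OF T1[OF that(1)] T1[OF that(2)]]) (use that in \<open>auto simp: transpose_def\<close>)
  have T4: "C 1 i j" if "i \<in> {3..6}" "j \<in> {3..6}" "i \<noteq> j" for i j
  proof -
    have "C j 1 i"
      by (rule conj[OF T1[OF that(1)] T2[OF that(2)]]) (use that in \<open>auto simp: transpose_def\<close>)
    then show ?thesis using rot[of j 1 i] that by auto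
  qed
  have T5: "C k i j" if "i \<in> {3..6}" "j \<in> {3..6}" "k \<in> {3..6}" "i \<noteq> j" "k \<noteq> i" "k \<noteq> j" for i j k
  proof -
    have "C 1 k 2" using T2[OF that(3)] rot[of 2 1 k] that(3) by auto
    then show ?thesis
      by (rule conj[OF T4[OF that(1,2,4)]]) (use that in \<open>auto simp: transpose_def\<close>)
  qed
  have all: "C a b c" if d: "distinct [a,b,c]" and s: "{a,b,c} \<subseteq> {1..6}" for a b c
  proof -
    have r: "C a b c \<longleftrightarrow> C b c a" "C a b c \<longleftrightarrow> C c a b"
      using rot[of a b c] rot[of c a b] d by auto
    have in36: "x \<in> {3..6}" if "x \<in> {a,b,c}" "x \<noteq> 1" "x \<noteq> 2" for x using that s by auto
    have one: "C 1 y z" if "{y,z} \<subseteq> {a,b,c}" "y \<noteq> 1" "z \<noteq> 1" "y \<noteq> z" for y z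
    proof -
      consider "y = 2" | "z = 2" | "y \<noteq> 2" "z \<noteq> 2" by blast
      then show ?thesis
      proof cases
        case 1 then show ?thesis using T1[OF in36[of z]] that by auto
      next
        case 2 then show ?thesis using T2[OF in36[of y]] rot[of 2 1 y] that by auto
      next
        case 3 then show ?thesis using T4[OF in36[of y] in36[of z]] that by auto
      qed
    qed
    have two: "C 2 y z" if "{y,z} \<subseteq> {a,b,c}" "y \<noteq> 1" "z \<noteq> 1" "y \<noteq> 2" "z \<noteq> 2" "y \<noteq> z" for y z
      using T3[OF in36[of z] in36[of y]] that by auto
    have three: "C a b c" if "1 \<notin> {a,b,c}" "2 \<notin> {a,b,c}"
      using T5[OF in36[of b] in36[of c] in36[of a]] that d by auto
    consider "a = 1" | "b = 1" | "c = 1" | "a = 2" "1 \<notin> {a,b,c}" | "b = 2" "1 \<notin> {a,b,c}"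
      | "c = 2" "1 \<notin> {a,b,c}" | "1 \<notin> {a,b,c}" "2 \<notin> {a,b,c}" by blast
    then show ?thesis
    proof cases
      case 1 then show ?thesis using one[of b c] d by auto
    next
      case 2 then show ?thesis using one[of c a] r(1) d by auto
    next
      case 3 then show ?thesis using one[of a b] r(2) d by auto
    next
      case 4 then show ?thesis using two[of b c] d by auto
    next
      case 5 then show ?thesis using two[of c a] r(1) d by auto
    next
      case 6 then show ?thesis using two[of a b] r(2) d by auto
    next
      case 7 then show ?thesis by (rule three)
    qed
  qed
  have "three_cycles 6 \<subseteq> D"
  proof
    fix x assume "x \<in> three_cycles 6"
    then obtain cs where cs: "x = cycle_of_list cs" "distinct cs" "length cs = 3" "set cs \<subseteq> {1..6}" by blast
    then obtain a b c where "cs = [a,b,c]" by (auto simp: numeral_3_eq_3 length_Suc_conv)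
    then show "x \<in> D" using all[of a b c] cs unfolding C_def by auto
  qed
  then have "generate (alt_group 6) (three_cycles 6) \<subseteq> D"
    by (rule A.generate_subgroup_incl[OF _ D])
  then show ?thesis using D.subset alt_group_carrier_as_three_cycles by blast
qed

declare cycle_of_list.simps [simp del]

text \<open>
  Write \<open>u\<close> and \<open>v\<close> for the two cycles. As \<open>u\<close> fixes \<open>f\<close>, the relation \<open>u v u v = 1\<close> evaluated at \<open>f\<close>
  gives \<open>v (u d) = f = v e\<close>, that is \<open>e = u d\<close>.
\<close>

lemma three_cycle_pair:
  assumes abc: "distinct [a,b,c]" and de: "distinct [d,e,f]" and f: "f \<notin> {a,b,c}"
    and inv: "(cycle_of_list [a,b,c] \<circ> cycle_of_list [d,e,f]) ^^ 2 = id"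
  shows "d \<in> {a,b,c} \<and> e = cycle_of_list [a,b,c] d"
proof -
  let ?u = "cycle_of_list [a,b,c]" and ?v = "cycle_of_list [d,e,f]"
  note u = three_cycle_apply[OF abc] and v = three_cycle_apply[OF de]
  have "?u (?v (?u (?v f))) = f" using fun_cong[OF inv, of f] by (simp add: numeral_2_eq_2)
  then have "?u (?v (?u d)) = ?u f" unfolding v(3) u(4)[OF f] .
  then have "?v (?u d) = ?v e" unfolding three_cycle_inj v(2) .
  then have e: "e = ?u d" unfolding three_cycle_inj by (rule sym)
  moreover have "d \<in> {a,b,c}"
  proof (rule ccontr)
    assume "d \<notin> {a,b,c}"
    then have "e = d" unfolding e by (rule u(4))
    then show False using de by simp
  qed
  ultimately show ?thesis by blast
qed

text \<open>
  A 3-cycle on the same three points would be \<open>(a b c)\<close> itself, whose fourth power is not trivial, or its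
  inverse; hence some point of \<open>(d e f)\<close> lies outside and can be rotated to the end.
\<close>

lemma three_cycle_meets_in_edge:
  assumes abc: "distinct [a,b,c]" and de: "distinct [d,e,f]"
    and inv: "(cycle_of_list [a,b,c] \<circ> cycle_of_list [d,e,f]) ^^ 2 = id"
    and ne: "cycle_of_list [a,b,c] \<circ> cycle_of_list [d,e,f] \<noteq> id"
  obtains i y where "i \<in> {a,b,c}" "y \<in> {d,e,f} - {a,b,c}"
    "cycle_of_list [d,e,f] = cycle_of_list [i, cycle_of_list [a,b,c] i, y]"
proof -
  let ?u = "cycle_of_list [a,b,c]"
  have rot: "cycle_of_list [d,e,f] = cycle_of_list [e,f,d]" "cycle_of_list [d,e,f] = cycle_of_list [f,d,e]"
    using three_cycle_rotate[OF de] three_cycle_rotate[of f d e] de by auto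
  have "\<not> {d,e,f} \<subseteq> {a,b,c}"
  proof
    assume "{d,e,f} \<subseteq> {a,b,c}"
    then have "[d,e,f] \<in> {[a,b,c],[b,c,a],[c,a,b],[a,c,b],[c,b,a],[b,a,c]}" using de by auto
    then have "cycle_of_list [d,e,f] = cycle_of_list [a,b,c] \<or> cycle_of_list [d,e,f] = cycle_of_list [a,c,b]"
      using three_cycle_rotate[of a b c] three_cycle_rotate[of b c a] three_cycle_rotate[of a c b] three_cycle_rotate[of c b a] abc
      by (elim insertE emptyE) auto
    then show False
    proof
      assume *: "cycle_of_list [d,e,f] = cycle_of_list [a,b,c]"
      have "b = a"
        using fun_cong[OF inv[unfolded *], of a] three_cycle_apply(1-3)[OF abc]
        by (simp add: numeral_2_eq_2)
      then show False using abc by simp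
    next
      assume *: "cycle_of_list [d,e,f] = cycle_of_list [a,c,b]"
      have "cycle_of_list [a,b,c] \<circ> cycle_of_list [a,c,b] = id"
        using abc by (auto simp: fun_eq_iff transpose_def cycle_of_list.simps)
      then show False using ne * by simp
    qed
  qed
  then consider "f \<notin> {a,b,c}" | "d \<notin> {a,b,c}" | "e \<notin> {a,b,c}" by blast
  then show thesis
  proof cases
    case 1
    then show thesis using three_cycle_pair[OF abc de 1 inv] that[of d f] by auto
  next
    case 2
    then show thesis
      using three_cycle_pair[OF abc _ 2 inv[unfolded rot(1)]] de that[of e d] rot(1) by auto
  next
    case 3
    then show thesis
      using three_cycle_pair[OF abc _ 3 inv[unfolded rot(2)]] de that[of f e] rot(2) by auto
  qed
qed

text \<open>
  Were the two edges of \<open>(a b c)\<close> different, a rotation of the second cycle would end in \<open>c\<close>, which is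
  not moved by \<open>(a b y)\<close>, and would start with an edge that \<open>(a b y)\<close> does not have.
\<close>

lemma three_cycles_share_edge:
  assumes abc: "distinct [a,b,c]" and y: "y \<notin> {a,b,c}" "z \<notin> {a,b,c}" and i: "i \<in> {a,b,c}"
    and inv: "(cycle_of_list [a,b,y] \<circ> cycle_of_list [i, cycle_of_list [a,b,c] i, z]) ^^ 2 = id"
  shows "i = a"
proof (rule ccontr)
  assume "i \<noteq> a"
  note u = three_cycle_apply[OF abc]
  have d: "distinct [a,b,y]" using abc y by auto
  note v = three_cycle_apply[OF d]
  consider (b) "i = b" | (c) "i = c" using i \<open>i \<noteq> a\<close> by blast
  then show False
  proof cases
    case b
    have inv': "(cycle_of_list [a,b,y] \<circ> cycle_of_list [b,c,z]) ^^ 2 = id" using inv unfolding b u(2) .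
    have dd: "distinct [z,b,c]" using abc y by auto
    have "cycle_of_list [z,b,c] = cycle_of_list [b,c,z]" by (rule three_cycle_rotate[OF dd])
    then have "z \<in> {a,b,y} \<and> b = cycle_of_list [a,b,y] z"
      using three_cycle_pair[OF d dd] inv' abc y by auto
    then show False using abc y v(3) by auto
  next
    case c
    have inv': "(cycle_of_list [a,b,y] \<circ> cycle_of_list [c,a,z]) ^^ 2 = id" using inv unfolding c u(3) .
    have dd: "distinct [a,z,c]" using abc y by auto
    have "cycle_of_list [c,a,z] = cycle_of_list [a,z,c]" by (rule three_cycle_rotate) (use dd in auto)
    then have "z = cycle_of_list [a,b,y] a"
      using three_cycle_pair[OF d dd] inv' abc y by auto
    then show False using abc y v(1) by auto
  qed
qed

text \<open>
  All four 3-cycles \<open>(1 2 k)\<close> are conjugate to \<open>(1 2 3)\<close>, so their images are 3-cycles, and these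
  share an oriented edge: they are \<open>(a b c)\<close>, \<open>(a b y4)\<close>, \<open>(a b y5)\<close>, \<open>(a b y6)\<close>. The permutation
  \<open>1, 2, 3, 4, 5, 6 \<mapsto> a, b, c, y4, y5, y6\<close> then induces the automorphism on generators.
\<close>

lemma auto_preserving_three_cycle_is_conj:
  assumes \<beta>: "\<beta> \<in> auto (alt_group 6)" and three: "\<beta> (cycle_of_list [1,2,3]) \<in> three_cycles 6"
  shows "\<exists>p. p permutes {1..6} \<and> \<beta> = conj_aut p"
proof -
  let ?A = "carrier (alt_group 6)"
  define s :: "nat \<Rightarrow> nat \<Rightarrow> nat" where "s k = cycle_of_list [1,2,k]" for k
  note B = auto_alt_groupD[OF \<beta>]
  have s3c: "s k \<in> three_cycles 6" if "k \<in> {3..6}" for k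
    unfolding s_def by (rule three_cycleI) (use that in auto)
  have sA: "s k \<in> ?A" if "k \<in> {3..6}" for k using s3c[OF that] three_cycles_incl by blast
  have Bs: "\<beta> (s k) \<in> three_cycles 6" if k: "k \<in> {3..6}" for k
  proof (cases "k = 3")
    case True
    then show ?thesis using three by (simp only: s_def)
  next
    case False
    \<comment> \<open>any point other than 1, 2, 3 and \<open>k\<close> makes \<open>(3 k m)\<close> carry \<open>(1 2 3)\<close> to \<open>(1 2 k)\<close>\<close>
    define m :: nat where "m = (if k = 4 then 5 else 4)"
    have k': "k \<in> {4,5,6}" using k False by auto
    let ?h = "cycle_of_list [3,k,m]"
    have "?h \<in> three_cycles 6" by (rule three_cycleI) (use k' in \<open>auto simp: m_def\<close>)
    then have hA: "?h \<in> ?A" using three_cycles_incl by blast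
    have "?h \<circ> s 3 \<circ> inv' ?h = cycle_of_list (map ?h [1,2,3])"
      unfolding s_def by (rule conjugation_of_cycle) (use alt_bij[OF hA] in auto)
    also have "map ?h [1,2,3] = [1,2,k]" using k' by (auto simp: m_def transpose_def cycle_of_list.simps)
    finally have "s k = ?h \<circ> s 3 \<circ> inv' ?h" unfolding s_def ..
    then have "\<beta> (s k) = \<beta> ?h \<circ> \<beta> (s 3) \<circ> inv' (\<beta> ?h)"
      using B(2)[OF alt_comp[OF hA sA[of 3]] alt_group_inv_closed[OF hA]] B(2)[OF hA sA[of 3]] B(6)[OF hA]
      by simp
    moreover have "\<beta> ?h permutes {1..6}" using B(1)[OF hA] unfolding alt_group_carrier by blast
    ultimately show ?thesis using three_cycles_conj three by (simp only: s_def)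
  qed
  have ss2: "(s k \<circ> s l) ^^ 2 = id" if "k \<in> {3..6}" "l \<in> {3..6}" "k \<noteq> l" for k l
  proof -
    have "k \<in> {3,4,5,6}" "l \<in> {3,4,5,6}" using that by auto
    then show ?thesis
      unfolding s_def using that(3)
      by (elim insertE emptyE; intro eq_on_six_points)
        (simp_all add: numeral_2_eq_2 transpose_def cycle_of_list.simps)
  qed
  have ss1: "s k \<circ> s l \<noteq> id" if "k \<in> {3..6}" "l \<in> {3..6}" "k \<noteq> l" for k l
  proof
    assume "s k \<circ> s l = id"
    from fun_cong[OF this, of 1] show False unfolding s_def using that by (auto simp: transpose_def cycle_of_list.simps split: if_splits)
  qed
  have BB2: "(\<beta> (s k) \<circ> \<beta> (s l)) ^^ 2 = id" if "k \<in> {3..6}" "l \<in> {3..6}" "k \<noteq> l" for k l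
    using ss2[OF that] B(2)[OF sA[OF that(1)] sA[OF that(2)]] B(3)
      B(5)[OF alt_comp[OF sA[OF that(1)] sA[OF that(2)]], of 2] by metis
  have idA: "id \<in> ?A" unfolding alt_group_carrier by (simp add: permutes_id)
  have BB1: "\<beta> (s k) \<circ> \<beta> (s l) \<noteq> id" if "k \<in> {3..6}" "l \<in> {3..6}" "k \<noteq> l" for k l
    using ss1[OF that] B(2)[OF sA[OF that(1)] sA[OF that(2)]] B(3)
      B(4)[OF alt_comp[OF sA[OF that(1)] sA[OF that(2)]] idA] by metis
  have three_list: "\<exists>a b c. x = cycle_of_list [a,b,c] \<and> distinct [a,b,c] \<and> {a,b,c} \<subseteq> {1..6}"
    if "x \<in> three_cycles 6" for x
  proof -
    obtain cs where cs: "x = cycle_of_list cs" "distinct cs" "length cs = 3" "set cs \<subseteq> {1..6}" using \<open>x \<in> three_cycles 6\<close> by blast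
    then obtain a b c where "cs = [a,b,c]" by (auto simp: numeral_3_eq_3 length_Suc_conv)
    then show ?thesis using cs by (metis empty_set list.simps(15))
  qed
  have edge: "\<exists>i y. i \<in> {a,b,c} \<and> y \<in> {1..6} - {a,b,c} \<and> \<beta> (s k) = cycle_of_list [i, cycle_of_list [a,b,c] i, y]"
    if "\<beta> (s 3) = cycle_of_list [a,b,c]" "distinct [a,b,c]" "k \<in> {4..6}" for a b c k
  proof -
    note ab = that(2)
    have k: "k \<in> {3..6}" "3 \<noteq> k" using that(3) by auto
    obtain d e f where def: "\<beta> (s k) = cycle_of_list [d,e,f]" "distinct [d,e,f]" "{d,e,f} \<subseteq> {1..6}"
      using three_list[OF Bs[OF k(1)]] by blast
    have I: "(cycle_of_list [a,b,c] \<circ> cycle_of_list [d,e,f]) ^^ 2 = id"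
      and N: "cycle_of_list [a,b,c] \<circ> cycle_of_list [d,e,f] \<noteq> id"
      using BB2[of 3 k] BB1[of 3 k] k unfolding that(1) def(1) by auto
    obtain i y where "i \<in> {a,b,c}" "y \<in> {d,e,f} - {a,b,c}"
      "cycle_of_list [d,e,f] = cycle_of_list [i, cycle_of_list [a,b,c] i, y]"
      by (rule three_cycle_meets_in_edge[OF ab def(2) I N])
    then show ?thesis using def(3) unfolding def(1) by blast
  qed
  obtain a0 b0 c0 where a0: "\<beta> (s 3) = cycle_of_list [a0,b0,c0]" "distinct [a0,b0,c0]" "{a0,b0,c0} \<subseteq> {1..6}"
    using three_list[OF Bs[of 3]] by auto
  \<comment> \<open>rotating the image of \<open>(1 2 3)\<close>, the edge it shares with the image of \<open>(1 2 4)\<close> becomes its first\<close>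
  obtain a b c y4 where abc: "\<beta> (s 3) = cycle_of_list [a,b,c]" "distinct [a,b,c]" "{a,b,c} \<subseteq> {1..6}"
    and y4: "\<beta> (s 4) = cycle_of_list [a,b,y4]" "y4 \<in> {1..6} - {a,b,c}"
  proof -
    obtain i y where iy: "i \<in> {a0,b0,c0}" "y \<in> {1..6} - {a0,b0,c0}"
      "\<beta> (s 4) = cycle_of_list [i, cycle_of_list [a0,b0,c0] i, y]"
      using edge[OF a0(1,2), of 4] by auto
    have rot: "cycle_of_list [a0,b0,c0] = cycle_of_list [b0,c0,a0]"
      "cycle_of_list [a0,b0,c0] = cycle_of_list [c0,a0,b0]"
      using three_cycle_rotate[of a0 b0 c0] three_cycle_rotate[of c0 a0 b0] a0(2) by simp_all
    note ap = three_cycle_apply[OF a0(2)]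
    from iy(1) show thesis
    proof (elim insertE emptyE)
      assume i: "i = a0"
      show thesis
        by (rule that[of a0 b0 c0 y, OF a0 iy(3)[unfolded i ap(1)] iy(2)])
    next
      assume i: "i = b0"
      show thesis
        by (rule that[of b0 c0 a0 y, OF a0(1)[unfolded rot(1)] _ _ iy(3)[unfolded i ap(2)]])
          (use a0(2,3) iy(2) in \<open>simp_all add: insert_commute\<close>)
    next
      assume i: "i = c0"
      show thesis
        by (rule that[of c0 a0 b0 y, OF a0(1)[unfolded rot(2)] _ _ iy(3)[unfolded i ap(3)]])
          (use a0(2,3) iy(2) in \<open>simp_all add: insert_commute\<close>)
    qed
  qed
  have others: "\<exists>y. \<beta> (s k) = cycle_of_list [a,b,y] \<and> y \<in> {1..6} - {a,b,c}" if k: "k \<in> {5,6}" for k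
  proof -
    have k46: "k \<in> {4..6}" using k by auto
    obtain i y where iy: "i \<in> {a,b,c}" "y \<in> {1..6} - {a,b,c}"
      "\<beta> (s k) = cycle_of_list [i, cycle_of_list [a,b,c] i, y]"
      using edge[OF abc(1,2) k46] by blast
    have "(cycle_of_list [a,b,y4] \<circ> cycle_of_list [i, cycle_of_list [a,b,c] i, y]) ^^ 2 = id"
      using BB2[of 4 k] k unfolding y4(1) iy(3)[symmetric] by auto
    then have "i = a" using three_cycles_share_edge[OF abc(2) _ _ iy(1)] y4(2) iy(2) by blast
    then show ?thesis using iy(2,3) three_cycle_apply(1)[OF abc(2)] by auto
  qed
  obtain y5 where y5: "\<beta> (s 5) = cycle_of_list [a,b,y5]" "y5 \<in> {1..6} - {a,b,c}" using others[of 5] by auto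
  obtain y6 where y6: "\<beta> (s 6) = cycle_of_list [a,b,y6]" "y6 \<in> {1..6} - {a,b,c}" using others[of 6] by auto
  have sne: "\<beta> (s k) \<noteq> \<beta> (s l)" if "k \<in> {3..6}" "l \<in> {3..6}" "k \<noteq> l" for k l
  proof
    assume "\<beta> (s k) = \<beta> (s l)"
    then have "s k = s l" using B(4)[OF sA[OF that(1)] sA[OF that(2)]] by blast
    from fun_cong[OF this, of 2] show False
      unfolding s_def using that by (auto simp: transpose_def cycle_of_list.simps split: if_splits)
  qed
  have "y4 \<noteq> y5" "y4 \<noteq> y6" "y5 \<noteq> y6"
    using sne[of 4 5] sne[of 4 6] sne[of 5 6] unfolding y4(1) y5(1) y6(1) by auto
  then have "distinct [a,b,c,y4,y5,y6]" "set [a,b,c,y4,y5,y6] \<subseteq> {1..6}"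
    using abc(2,3) y4(2) y5(2) y6(2) by auto
  then obtain p where p: "p permutes {1..6}" "map p [1,2,3,4,5,6] = [a,b,c,y4,y5,y6]"
    using ex_permutes_map_lists[of "{1..6::nat}" "[1,2,3,4,5,6]" "[a,b,c,y4,y5,y6]"] by auto
  have agree: "conj_aut p (s k) = \<beta> (s k)" if k: "k \<in> {3..6}" for k
  proof -
    have "conj_aut p (s k) = p \<circ> s k \<circ> inv' p" using sA[OF k] by (simp add: conj_aut_def)
    also have "\<dots> = cycle_of_list (map p [1,2,k])"
      unfolding s_def by (rule conjugation_of_cycle) (use k permutes_bij[OF p(1)] in auto)
    also have "\<dots> = \<beta> (s k)"
    proof -
      consider "k = 3" | "k = 4" | "k = 5" | "k = 6" using k by fastforce
      then show ?thesis using p(2) abc(1) y4(1) y5(1) y6(1) by cases auto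
    qed
    finally show ?thesis .
  qed
  define D where "D = {x \<in> ?A. conj_aut p x = \<beta> x}"
  note P = auto_alt_groupD[OF conj_aut_in_auto[OF p(1)]]
  interpret A: group "alt_group 6" by (rule alt_group_is_group)
  have "subgroup D (alt_group 6)"
  proof (rule A.subgroupI)
    show "D \<subseteq> ?A" by (auto simp: D_def)
    have "id \<in> D" using idA B(3) P(3) unfolding D_def by simp
    then show "D \<noteq> {}" by blast
    show "inv\<^bsub>alt_group 6\<^esub> x \<in> D" if "x \<in> D" for x
      using that B(6)[of x] P(6)[of x] alt_group_inv_closed[of x 6] by (auto simp: D_def alt_group_inv_equality)
    show "x \<otimes>\<^bsub>alt_group 6\<^esub> y \<in> D" if "x \<in> D" "y \<in> D" for x y
      using that B(2)[of x y] P(2)[of x y] alt_comp[of x 6 y] by (auto simp: D_def alt_group_mult)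
  qed
  moreover have "cycle_of_list [1,2,k] \<in> D" if "k \<in> {3..6}" for k
    using agree[OF that] sA[OF that] unfolding D_def s_def by blast
  ultimately have "x \<in> D" if "x \<in> ?A" for x using star_three_cycles_generate that by blast
  then have "\<beta> x = conj_aut p x" if "x \<in> ?A" for x using that by (simp add: D_def)
  then have "\<beta> = conj_aut p" by (rule extensionalityI[OF B(7) P(7)])
  then show ?thesis using p(1) by blast
qed

lemma dual_pairI_points:
  assumes "p permutes {1..6}" "q permutes {1..6}" "evenperm p = evenperm q"
    and "\<forall>i\<in>set points. \<forall>j\<in>set points. if i = j then True else \<forall>x\<in>set points.
           syntheme (q i) (q j) (p x) = p (syntheme i j x)"
  shows "dual_pair p q"
  using assms unfolding dual_pair_def set_points by meson

text \<open>
  Since conjugation preserves cycle types, this single value shows that the exotic automorphism maps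
  products of two 3-cycles to 3-cycles.
\<close>

lemma exotic_rep33: "exotic rep33 = cycle_of_list [1,6,3]"
proof (rule exotic_eqI)
  have 1: "rep33 permutes {1..6}"
    by (intro permutes_compose permutes_subset[OF cycle_permutes]) auto
  have 2: "cycle_of_list [1,6,3::nat] permutes {1..6}"
    by (intro permutes_subset[OF cycle_permutes]) auto
  have e: "evenperm (cycle_of_list [a,b,c])" if "distinct [a,b,c]" for a b c :: nat
    using evenperm_cycle_of_list[OF that] by auto
  show ev: "evenperm rep33"
    by (subst evenperm_comp) (simp_all only: permutation_of_cycle, use e in auto)
  show "dual_pair rep33 (cycle_of_list [1,6,3])"
  proof (rule dual_pairI_points[OF 1 2])
    show "evenperm rep33 = evenperm (cycle_of_list [1,6,3::nat])" using ev e[of 1 6 3] by simp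
    show "\<forall>i\<in>set points. \<forall>j\<in>set points. if i = j then True else \<forall>x\<in>set points.
      syntheme (cycle_of_list [1,6,3] i) (cycle_of_list [1,6,3] j) (rep33 x) = rep33 (syntheme i j x)"
      by code_simp
  qed
qed

text \<open>
  The image of \<open>(1 2 3)\<close> has order 3, so it is a 3-cycle or a product of two; in the latter case
  the exotic involution turns it back into a 3-cycle.
\<close>

lemma auto_alt_group_6_cases:
  assumes \<alpha>: "\<alpha> \<in> auto (alt_group 6)"
  obtains p where "p permutes {1..6}" "\<alpha> = conj_aut p \<or> \<alpha> = compose (carrier (alt_group 6)) exotic (conj_aut p)"
proof -
  let ?A = "carrier (alt_group 6)"
  note a = auto_alt_groupD[OF \<alpha>] and E = auto_alt_groupD[OF exotic_in_auto]
  have t3: "rep3 \<in> three_cycles 6" by (rule three_cycleI) auto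
  then have A3: "rep3 \<in> ?A" using three_cycles_incl by blast
  have A: "\<alpha> rep3 \<in> ?A" using a(1)[OF A3] .
  have "rep3 \<noteq> id" by (rule moved_imp_neq_id[of _ 1]) (simp add: transpose_def cycle_of_list.simps)
  then have "\<alpha> rep3 ^^ 3 = id" "\<alpha> rep3 \<noteq> id"
    using a(5)[OF A3, of 3] rep_orders(2) a(3) a(4)[OF A3 group.is_monoid[OF alt_group_is_group, THEN monoid.one_closed, unfolded alt_group_one]]
    by metis+
  then obtain r q where r: "r \<in> ?A" "q \<in> {rep3, rep33}" "r \<circ> \<alpha> rep3 = q \<circ> r"
    using alt_group_6_order_three[OF A] by metis
  have rp: "r permutes {1..6}" using r(1) unfolding alt_group_carrier by blast
  have ar: "\<alpha> rep3 = inv' r \<circ> q \<circ> r"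
    using r(3) permutes_inv_o(2)[OF rp] by (metis comp_assoc id_comp)
  have ir: "inv' r \<in> ?A" by (rule alt_group_inv_closed[OF r(1)])
  from r(2) show thesis
  proof (elim insertE emptyE)
    assume "q = rep3"
    then have "\<alpha> rep3 \<in> three_cycles 6"
      using three_cycles_conj[OF t3 permutes_inv[OF rp]] permutes_inv_inv[OF rp] ar by simp
    then show thesis using auto_preserving_three_cycle_is_conj[OF \<alpha>] that by blast
  next
    assume q: "q = rep33"
    let ?\<beta> = "compose ?A exotic \<alpha>"
    have qA: "rep33 \<in> ?A"
      using three_cycles_incl three_cycleI[of 1 2 3 6] three_cycleI[of 4 5 6 6] by (intro alt_comp) auto
    have "?\<beta> rep3 = exotic (inv' r) \<circ> exotic rep33 \<circ> exotic r"
      using A3 ar q E(2)[OF alt_comp[OF ir qA] r(1)] E(2)[OF ir qA] by (simp add: compose_eq)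
    also have "\<dots> = inv' (exotic r) \<circ> cycle_of_list [1,6,3] \<circ> inv' (inv' (exotic r))"
      using E(6)[OF r(1)] exotic_rep33 inv_inv_eq[OF alt_bij[OF E(1)[OF r(1)]]] by simp
    also have "\<dots> \<in> three_cycles 6"
      using E(1)[OF r(1)] unfolding alt_group_carrier
      by (intro three_cycles_conj permutes_inv three_cycleI) auto
    finally have "?\<beta> rep3 \<in> three_cycles 6" .
    moreover have "?\<beta> \<in> auto (alt_group 6)"
      using exotic_in_auto \<alpha> group.hom_compose[OF alt_group_is_group] compose_Bij
      unfolding auto_def by blast
    ultimately obtain p where p: "p permutes {1..6}" "?\<beta> = conj_aut p"
      using auto_preserving_three_cycle_is_conj by blast
    have "\<alpha> = compose ?A exotic (conj_aut p)"
    proof (rule extensionalityI[OF a(7)])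
      show "compose ?A exotic (conj_aut p) \<in> extensional ?A" by (simp add: compose_def)
      show "\<alpha> x = compose ?A exotic (conj_aut p) x" if "x \<in> ?A" for x
        unfolding p(2)[symmetric] using that exotic_exotic[OF a(1)[OF that]] by (simp add: compose_eq)
    qed
    then show thesis using that p(1) by blast
  qed
qed

section \<open>Index two subgroups in the automorphism group\<close>

abbreviation Aut6 :: "((nat \<Rightarrow> nat) \<Rightarrow> (nat \<Rightarrow> nat)) monoid" where
  "Aut6 \<equiv> AutoGroup (alt_group 6)"

lemma Aut6_simps:
  "carrier Aut6 = auto (alt_group 6)"
  "\<one>\<^bsub>Aut6\<^esub> = (\<lambda>x\<in>carrier (alt_group 6). x)"
  "f \<in> auto (alt_group 6) \<Longrightarrow> g \<in> auto (alt_group 6) \<Longrightarrow> f \<otimes>\<^bsub>Aut6\<^esub> g = compose (carrier (alt_group 6)) f g"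
  by (auto simp: AutoGroup_def BijGroup_def auto_def)

lemma group_Aut6: "group Aut6"
  by (rule group.AutoGroup[OF alt_group_is_group])

lemma conj_aut_mult:
  assumes "p permutes {1..6}" "q permutes {1..6}"
  shows "conj_aut p \<otimes>\<^bsub>Aut6\<^esub> conj_aut q = conj_aut (p \<circ> q)"
  using Aut6_simps(3)[OF assms[THEN conj_aut_in_auto]] conj_aut_comp[OF assms] by simp

lemma conj_aut_one: "conj_aut id = \<one>\<^bsub>Aut6\<^esub>"
  by (simp add: conj_aut_id Aut6_simps)

lemma conj_aut_inv:
  assumes "p permutes {1..6}" shows "inv\<^bsub>Aut6\<^esub> conj_aut p = conj_aut (inv' p)"
proof -
  interpret group Aut6 by (rule group_Aut6)
  have "conj_aut (inv' p) \<otimes>\<^bsub>Aut6\<^esub> conj_aut p = \<one>\<^bsub>Aut6\<^esub>"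
    using conj_aut_mult[OF permutes_inv[OF assms] assms] permutes_inv_o(2)[OF assms] conj_aut_one by simp
  then show ?thesis
    using conj_aut_in_auto[OF assms] conj_aut_in_auto[OF permutes_inv[OF assms]]
    by (intro inv_equality) (simp_all add: Aut6_simps(1))
qed

lemma alt_permutes: "p \<in> carrier (alt_group n) \<Longrightarrow> p permutes {1..n}"
  unfolding alt_group_carrier by blast

lemma Aut6_cases:
  assumes "\<alpha> \<in> carrier Aut6"
  obtains p where "p permutes {1..6}" "\<alpha> = conj_aut p \<or> \<alpha> = exotic \<otimes>\<^bsub>Aut6\<^esub> conj_aut p"
  using auto_alt_group_6_cases[of \<alpha>] assms Aut6_simps(3)[OF exotic_in_auto conj_aut_in_auto]
  unfolding Aut6_simps(1) by metis

text \<open>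
  Any odd permutation represents the nontrivial coset of the alternating group.
\<close>

lemma conj_odd_imp_conj_all:
  assumes K: "subgroup K Aut6" and inn: "conj_aut ` carrier (alt_group 6) \<subseteq> K"
    and p: "p permutes {1..6}" "\<not> evenperm p" "conj_aut p \<in> K" and q: "q permutes {1..6}"
  shows "conj_aut q \<in> K"
proof (cases "evenperm q")
  case True
  then have "q \<in> carrier (alt_group 6)" using q unfolding alt_group_carrier by blast
  then show ?thesis using inn by blast
next
  case False
  note perm = permutes_imp_permutation[OF finite_atLeastAtMost]
  note ip = permutes_inv[OF p(1)]
  have "evenperm (q \<circ> inv' p)"
    using evenperm_comp[OF perm[OF q] perm[OF ip]] evenperm_inv[OF perm[OF p(1)]] False p(2) by blast
  then have "q \<circ> inv' p \<in> carrier (alt_group 6)"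
    using permutes_compose[OF ip q] unfolding alt_group_carrier by blast
  then have "conj_aut (q \<circ> inv' p) \<otimes>\<^bsub>Aut6\<^esub> conj_aut p \<in> K"
    using inn p(3) by (intro subgroup.m_closed[OF K]) auto
  moreover have "(q \<circ> inv' p) \<circ> p = q" using permutes_inv_o(2)[OF p(1)] by (simp add: comp_assoc)
  ultimately show ?thesis using conj_aut_mult[OF permutes_compose[OF ip q] p(1)] by simp
qed

text \<open>
  A 3-cycle \<open>c\<close> is the square of \<open>c\<^sup>2\<close>, and 3-cycles generate.
\<close>

lemma squares_generate_inner:
  assumes K: "subgroup K Aut6"
    and sq: "\<And>a. a \<in> carrier (alt_group 6) \<Longrightarrow> conj_aut a \<otimes>\<^bsub>Aut6\<^esub> conj_aut a \<in> K"
  shows "conj_aut ` carrier (alt_group 6) \<subseteq> K"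
proof -
  let ?A = "carrier (alt_group 6)"
  interpret A: group "alt_group 6" by (rule alt_group_is_group)
  interpret K: subgroup K Aut6 by (rule K)
  define D where "D = {a \<in> ?A. conj_aut a \<in> K}"
  have "subgroup D (alt_group 6)"
  proof (rule A.subgroupI)
    show "D \<subseteq> ?A" by (auto simp: D_def)
    have "id \<in> D" using A.one_closed K.one_closed unfolding D_def conj_aut_one[symmetric] alt_group_one by blast
    then show "D \<noteq> {}" by blast
    show "inv\<^bsub>alt_group 6\<^esub> x \<in> D" if "x \<in> D" for x
    proof -
      have x: "x \<in> ?A" "conj_aut x \<in> K" using that unfolding D_def by blast+
      show ?thesis
        using alt_group_inv_closed[OF x(1)] K.m_inv_closed[OF x(2)]
        unfolding D_def alt_group_inv_equality[OF x(1)] conj_aut_inv[OF alt_permutes[OF x(1)]] by blast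
    qed
    show "x \<otimes>\<^bsub>alt_group 6\<^esub> y \<in> D" if "x \<in> D" "y \<in> D" for x y
    proof -
      have x: "x \<in> ?A" "conj_aut x \<in> K" and y: "y \<in> ?A" "conj_aut y \<in> K"
        using that unfolding D_def by blast+
      show ?thesis
        using alt_comp[OF x(1) y(1)] K.m_closed[OF x(2) y(2)]
        unfolding D_def alt_group_mult conj_aut_mult[OF x(1)[THEN alt_permutes] y(1)[THEN alt_permutes]]
        by blast
    qed
  qed
  moreover have "three_cycles 6 \<subseteq> D"
  proof
    fix c assume c: "c \<in> three_cycles 6"
    then obtain cs where cs: "c = cycle_of_list cs" "distinct cs" "length cs = 3" by blast
    have cA: "c \<in> ?A" using c three_cycles_incl by blast
    have ccA: "c \<circ> c \<in> ?A" by (rule alt_comp[OF cA cA])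
    have "c ^^ 3 = id" using cycle_is_id_root[OF cs(2)] unfolding cs(1,3) .
    then have "c \<circ> (c \<circ> c) = id" unfolding numeral_3_eq_3 funpow.simps comp_id .
    moreover have "(c \<circ> c) \<circ> (c \<circ> c) = (c \<circ> (c \<circ> c)) \<circ> c" by (simp only: comp_assoc)
    ultimately have "(c \<circ> c) \<circ> (c \<circ> c) = c" by (simp only: id_comp)
    then have "conj_aut c = conj_aut (c \<circ> c) \<otimes>\<^bsub>Aut6\<^esub> conj_aut (c \<circ> c)"
      by (simp only: conj_aut_mult[OF alt_permutes[OF ccA] alt_permutes[OF ccA]])
    then have "conj_aut c \<in> K" using sq[OF ccA] by (simp only:)
    then show "c \<in> D" using cA unfolding D_def by blast
  qed
  ultimately have "?A \<subseteq> D"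
    unfolding alt_group_carrier_as_three_cycles by (intro A.generate_subgroup_incl)
  then show ?thesis unfolding D_def by blast
qed

text \<open>
  If \<open>K\<close> contains an outer automorphism \<open>k\<close> and \<open>g\<close> lies outside \<open>K\<close>, then \<open>k\<close>, \<open>g\<close> and \<open>k\<inverse> g\<close> are
  all outer. Among them there is a conjugation by an odd permutation, and one that involves the exotic
  automorphism, so \<open>H\<close> contains everything; and as \<open>K\<close> is proper, one of the two generating
  involutions is missing from it.
\<close>

lemma index_two_in_Aut6:
  assumes H: "subgroup H Aut6" and inn: "conj_aut ` carrier (alt_group 6) \<subset> H"
    and K: "subgroup K Aut6" "K \<subset> H"
    and two: "\<And>g h. g \<in> H - K \<Longrightarrow> h \<in> H - K \<Longrightarrow> g \<otimes>\<^bsub>Aut6\<^esub> h \<in> K"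
  shows "K = conj_aut ` carrier (alt_group 6) \<or> (\<exists>g\<in>H - K. g \<otimes>\<^bsub>Aut6\<^esub> g = \<one>\<^bsub>Aut6\<^esub>)"
proof -
  let ?I = "conj_aut ` carrier (alt_group 6)"
  interpret Au: group Aut6 by (rule group_Aut6)
  interpret H: subgroup H Aut6 by (rule H)
  interpret K: subgroup K Aut6 by (rule K(1))
  have IK: "?I \<subseteq> K"
  proof (rule squares_generate_inner[OF K(1)])
    fix a assume "a \<in> carrier (alt_group 6)"
    then have "conj_aut a \<in> H" using inn by blast
    then show "conj_aut a \<otimes>\<^bsub>Aut6\<^esub> conj_aut a \<in> K"
      by (cases "conj_aut a \<in> K") (blast intro: two K.m_closed)+
  qed
  note perm = permutes_imp_permutation[OF finite_atLeastAtMost]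
  have even_inn: "conj_aut p \<in> ?I" if "p permutes {1..6}" "evenperm p" for p
    by (rule imageI) (use that in \<open>simp only: alt_group_carrier\<close>)
  show ?thesis
  proof (cases "K = ?I")
    case False
    then obtain k where k: "k \<in> K" "k \<notin> ?I" using IK by blast
    obtain g where g: "g \<in> H" "g \<notin> K" using K(2) by blast
    have kH: "k \<in> H" using k K(2) by blast
    have kc: "k \<in> carrier Aut6" and gc: "g \<in> carrier Aut6" using kH g H.mem_carrier by blast+
    define d where "d = inv\<^bsub>Aut6\<^esub> k \<otimes>\<^bsub>Aut6\<^esub> g"
    have dH: "d \<in> H" unfolding d_def using kH g(1) by blast
    have dK: "d \<notin> K"
    proof
      assume "d \<in> K"
      then have "k \<otimes>\<^bsub>Aut6\<^esub> d \<in> K" using k(1) by blast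
      moreover have "k \<otimes>\<^bsub>Aut6\<^esub> d = g" unfolding d_def using kc gc by (simp add: Au.m_assoc[symmetric])
      ultimately show False using g(2) by simp
    qed
    obtain p where p: "p permutes {1..6}" "k = conj_aut p \<or> k = exotic \<otimes>\<^bsub>Aut6\<^esub> conj_aut p"
      using Aut6_cases[OF kc] by blast
    obtain q where q: "q permutes {1..6}" "g = conj_aut q \<or> g = exotic \<otimes>\<^bsub>Aut6\<^esub> conj_aut q"
      using Aut6_cases[OF gc] by blast
    have pq: "inv' p \<circ> q permutes {1..6}" by (rule permutes_compose[OF q(1) permutes_inv[OF p(1)]])
    have ev_pq: "evenperm (inv' p \<circ> q) \<longleftrightarrow> evenperm p = evenperm q"
      using evenperm_comp[OF perm[OF permutes_inv[OF p(1)]] perm[OF q(1)]] evenperm_inv[OF perm[OF p(1)]] by blast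
    have ex: "exotic \<in> carrier Aut6" using exotic_in_auto by (simp add: Aut6_simps(1))
    have pc: "conj_aut p \<in> carrier Aut6" and qc: "conj_aut q \<in> carrier Aut6"
      using conj_aut_in_auto p(1) q(1) by (simp_all add: Aut6_simps(1))
    have d_conj: "d = conj_aut (inv' p \<circ> q)"
      if "(k = conj_aut p \<and> g = conj_aut q) \<or>
          (k = exotic \<otimes>\<^bsub>Aut6\<^esub> conj_aut p \<and> g = exotic \<otimes>\<^bsub>Aut6\<^esub> conj_aut q)"
    proof -
      have "d = inv\<^bsub>Aut6\<^esub> conj_aut p \<otimes>\<^bsub>Aut6\<^esub> conj_aut q"
        using that
      proof
        assume *: "k = exotic \<otimes>\<^bsub>Aut6\<^esub> conj_aut p \<and> g = exotic \<otimes>\<^bsub>Aut6\<^esub> conj_aut q"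
        have "d = inv\<^bsub>Aut6\<^esub> conj_aut p \<otimes>\<^bsub>Aut6\<^esub> (inv\<^bsub>Aut6\<^esub> exotic \<otimes>\<^bsub>Aut6\<^esub> (exotic \<otimes>\<^bsub>Aut6\<^esub> conj_aut q))"
          unfolding d_def using * ex pc qc by (simp add: Au.inv_mult_group Au.m_assoc)
        also have "inv\<^bsub>Aut6\<^esub> exotic \<otimes>\<^bsub>Aut6\<^esub> (exotic \<otimes>\<^bsub>Aut6\<^esub> conj_aut q) = conj_aut q"
          using ex qc by (simp add: Au.m_assoc[symmetric])
        finally show ?thesis .
      qed (simp add: d_def)
      then show ?thesis
        using conj_aut_inv[OF p(1)] conj_aut_mult[OF permutes_inv[OF p(1)] q(1)] by simp
    qed
    have odd: "\<exists>r. r permutes {1..6} \<and> \<not> evenperm r \<and> conj_aut r \<in> H"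
    proof -
      consider "k = conj_aut p" | "g = conj_aut q" | "d = conj_aut (inv' p \<circ> q)"
        using p(2) q(2) d_conj by blast
      then show ?thesis
      proof cases
        case 1 then show ?thesis using k(2) kH p(1) even_inn by blast
      next
        case 2 then show ?thesis using g q(1) even_inn IK by blast
      next
        case 3
        have "\<not> evenperm (inv' p \<circ> q)"
          using even_inn[OF pq] dK IK unfolding 3[symmetric] by blast
        then show ?thesis using dH pq unfolding 3 by blast
      qed
    qed
    have allH: "conj_aut r \<in> H" if "r permutes {1..6}" for r
      using odd conj_odd_imp_conj_all[OF H _ _ _ _ that] inn by blast
    have exH: "exotic \<in> H"
    proof -
      have *: "exotic \<in> H" if "exotic \<otimes>\<^bsub>Aut6\<^esub> conj_aut r \<in> H" "r permutes {1..6}" for r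
      proof -
        have "(exotic \<otimes>\<^bsub>Aut6\<^esub> conj_aut r) \<otimes>\<^bsub>Aut6\<^esub> inv\<^bsub>Aut6\<^esub> conj_aut r \<in> H"
          using that(1) allH[OF that(2)] by blast
        moreover have "conj_aut r \<in> carrier Aut6"
          using conj_aut_in_auto[OF that(2)] by (simp add: Aut6_simps(1))
        ultimately show ?thesis using ex by (simp add: Au.m_assoc)
      qed
      have "\<not> (k = conj_aut p \<and> g = conj_aut q)"
      proof
        assume kg: "k = conj_aut p \<and> g = conj_aut q"
        then have "\<not> evenperm p" "\<not> evenperm q" using k(2) g(2) even_inn p(1) q(1) IK by blast+
        then have "d \<in> ?I" using d_conj kg ev_pq even_inn[OF pq] by simp
        then show False using dK IK by blast
      qed
      then show ?thesis using p q kH g(1) * by blast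
    qed
    define t where "t = transpose 1 (2::nat)"
    have t: "t permutes {1..6}" "\<not> evenperm t" "t \<circ> t = id"
      unfolding t_def by (auto intro: permutes_swap_id simp: evenperm_swap)
    have "conj_aut t \<notin> K \<or> exotic \<notin> K"
    proof (rule ccontr)
      assume "\<not> (conj_aut t \<notin> K \<or> exotic \<notin> K)"
      then have "conj_aut t \<in> K" "exotic \<in> K" by blast+
      then have allK: "conj_aut r \<in> K" if "r permutes {1..6}" for r
        using conj_odd_imp_conj_all[OF K(1) IK t(1,2) _ that] by blast
      obtain r where "r permutes {1..6}" "g = conj_aut r \<or> g = exotic \<otimes>\<^bsub>Aut6\<^esub> conj_aut r"
        using Aut6_cases[OF gc] by blast
      then have "g \<in> K" using allK \<open>exotic \<in> K\<close> by blast
      then show False using g(2) by blast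
    qed
    moreover have "conj_aut t \<otimes>\<^bsub>Aut6\<^esub> conj_aut t = \<one>\<^bsub>Aut6\<^esub>"
      using conj_aut_mult[OF t(1,1)] t(3) conj_aut_one by simp
    moreover have "exotic \<otimes>\<^bsub>Aut6\<^esub> exotic = \<one>\<^bsub>Aut6\<^esub>"
      using Aut6_simps(2,3) exotic_in_auto exotic_order_two by simp
    ultimately show ?thesis using allH[OF t(1)] exH by blast
  qed blast
qed

text \<open>
  If \<open>p\<close> moved \<open>x\<close>, then a 3-cycle through \<open>x\<close> that avoids \<open>p x\<close> would not commute with \<open>p\<close>.
\<close>

lemma conj_aut_trivial:
  assumes p: "p permutes {1..6}" and one: "conj_aut p = \<one>\<^bsub>Aut6\<^esub>"
  shows "p = id"
proof (rule ccontr)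
  assume "p \<noteq> id"
  then obtain x where x: "p x \<noteq> x" by (auto simp: fun_eq_iff)
  then have x6: "x \<in> {1..6}" using permutes_not_in[OF p] by blast
  have "card ({1..6} - {x, p x}) = 4"
    using x x6 permutes_in_image[OF p] by (subst card_Diff_subset) auto
  then have "2 \<le> card ({1..6} - {x, p x})" by simp
  then obtain B where B: "B \<subseteq> {1..6} - {x, p x}" "card B = 2" by (meson obtain_subset_with_card_n)
  then obtain b c where bc: "b \<noteq> c" "b \<in> {1..6} - {x, p x}" "c \<in> {1..6} - {x, p x}"
    by (metis card_2_iff insert_subset)
  have d: "distinct [x,b,c]" using bc by auto
  have cA: "cycle_of_list [x,b,c] \<in> carrier (alt_group 6)"
    using three_cycles_incl three_cycleI[OF d, of 6] bc x6 by blast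
  have "p \<circ> cycle_of_list [x,b,c] \<circ> inv' p = cycle_of_list [x,b,c]"
    using fun_cong[OF one, of "cycle_of_list [x,b,c]"] cA by (simp add: conj_aut_def Aut6_simps(2))
  then have "p (cycle_of_list [x,b,c] x) = cycle_of_list [x,b,c] (p x)"
    using permutes_inverses(2)[OF p] by (metis comp_apply)
  also have "\<dots> = p x" by (rule three_cycle_apply(4)[OF d]) (use x bc in auto)
  finally have "p b = p x" using three_cycle_apply(1)[OF d] by simp
  then have "b = x" using permutes_inj[OF p] by (auto dest: injD)
  then show False using bc by blast
qed

lemma conj_aut_conjugate:
  assumes \<gamma>: "\<gamma> \<in> auto (alt_group 6)" and \<delta>: "\<delta> \<in> auto (alt_group 6)"
    and inv: "\<gamma> \<otimes>\<^bsub>Aut6\<^esub> \<delta> = \<one>\<^bsub>Aut6\<^esub>" and a: "a \<in> carrier (alt_group 6)"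
  shows "(\<gamma> \<otimes>\<^bsub>Aut6\<^esub> conj_aut a) \<otimes>\<^bsub>Aut6\<^esub> \<delta> = conj_aut (\<gamma> a)"
proof -
  let ?A = "carrier (alt_group 6)"
  interpret Au: group Aut6 by (rule group_Aut6)
  note C = auto_alt_groupD[OF \<gamma>] and D = auto_alt_groupD[OF \<delta>]
  have ca: "conj_aut a \<in> auto (alt_group 6)" by (rule conj_aut_in_auto[OF alt_permutes[OF a]])
  have m: "\<gamma> \<otimes>\<^bsub>Aut6\<^esub> conj_aut a \<in> auto (alt_group 6)"
    using Au.m_closed[of \<gamma> "conj_aut a"] \<gamma> ca unfolding Aut6_simps(1) by blast
  have prod: "(\<gamma> \<otimes>\<^bsub>Aut6\<^esub> conj_aut a) \<otimes>\<^bsub>Aut6\<^esub> \<delta> = compose ?A (compose ?A \<gamma> (conj_aut a)) \<delta>"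
    using Aut6_simps(3)[OF m \<delta>] Aut6_simps(3)[OF \<gamma> ca] by simp
  show ?thesis
    unfolding prod
  proof (rule extensionalityI[of _ ?A])
    fix t assume t: "t \<in> ?A"
    have ti: "\<gamma> (\<delta> t) = t"
      using fun_cong[OF inv, of t] t unfolding Aut6_simps(3)[OF \<gamma> \<delta>] Aut6_simps(2) by (simp add: compose_eq)
    have "compose ?A (compose ?A \<gamma> (conj_aut a)) \<delta> t = \<gamma> (a \<circ> \<delta> t \<circ> inv' a)"
      using t D(1)[OF t] by (simp add: compose_eq conj_aut_def)
    also have "\<dots> = \<gamma> a \<circ> \<gamma> (\<delta> t) \<circ> inv' (\<gamma> a)"
      by (simp only: C(2)[OF alt_comp[OF a D(1)[OF t]] alt_group_inv_closed[OF a]] C(2)[OF a D(1)[OF t]] C(6)[OF a])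
    finally show "compose ?A (compose ?A \<gamma> (conj_aut a)) \<delta> t = conj_aut (\<gamma> a) t"
      using t by (simp add: ti conj_aut_def)
  qed (simp_all add: compose_def conj_aut_def)
qed

section \<open>Absence of mixed Beauville structures\<close>

lemma alt_group_pow: "x [^]\<^bsub>alt_group m\<^esub> (n::nat) = x ^^ n"
proof (induction n)
  case 0
  show ?case unfolding nat_pow_0 alt_group_one funpow.simps ..
next
  case (Suc n)
  show ?case unfolding nat_pow_Suc Suc alt_group_mult funpow_Suc_right ..
qed

lemma beauville_SigmaI:
  assumes "h \<in> G0" "s \<in> {x, y, z}"
  shows "h \<otimes>\<^bsub>G\<^esub> (s [^]\<^bsub>G\<^esub> (j::nat)) \<otimes>\<^bsub>G\<^esub> inv\<^bsub>G\<^esub> h \<in> beauville_Sigma G G0 x y z"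
  using assms unfolding beauville_Sigma_def by blast

theorem mainTheorem5:
  fixes G :: "('a, 'b) monoid_scheme" and H :: "((nat \<Rightarrow> nat) \<Rightarrow> (nat \<Rightarrow> nat)) set"
  assumes "group G"
    and "subgroup H (AutoGroup (alt_group 6))"
    and "inner_automorphisms (alt_group 6) \<subset> H"
    and "G \<cong> (AutoGroup (alt_group 6))\<lparr>carrier := H\<rparr>"
  shows "\<not> (\<exists>S. mixed_beauville_structure G S)"
proof
  assume "\<exists>S. mixed_beauville_structure G S"
  then obtain S where S: "mixed_beauville_structure G S" by blast
  let ?A = "carrier (alt_group 6)" and ?I = "conj_aut ` carrier (alt_group 6)"
  let ?M = "Aut6\<lparr>carrier := H\<rparr>"
  interpret G: group G by (rule assms(1))
  interpret A: group "alt_group 6" by (rule alt_group_is_group)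
  interpret Au: group Aut6 by (rule group_Aut6)
  interpret H: subgroup H Aut6 by (rule assms(2))
  interpret M: group ?M by (rule H.subgroup_is_group[OF Au.is_group])
  have inn: "?I \<subset> H" using assms(3) unfolding inner_automorphisms_alt_group_6 .
  obtain \<phi> where \<phi>: "\<phi> \<in> iso G ?M" using assms(4) unfolding is_iso_def by blast
  interpret \<phi>: group_hom G ?M \<phi>
    using \<phi> by unfold_locales (simp add: iso_def)
  have bij: "bij_betw \<phi> (carrier G) H" using \<phi> by (simp add: iso_def)
  have \<phi>_inj: "g = h" if "g \<in> carrier G" "h \<in> carrier G" "\<phi> g = \<phi> h" for g h
    using that bij by (auto simp: bij_betw_def dest: inj_onD)
  have \<phi>_mult: "\<phi> (g \<otimes>\<^bsub>G\<^esub> h) = \<phi> g \<otimes>\<^bsub>Aut6\<^esub> \<phi> h" if "g \<in> carrier G" "h \<in> carrier G" for g h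
    using \<phi>.hom_mult[OF that] by simp
  have \<phi>_one: "\<phi> \<one>\<^bsub>G\<^esub> = \<one>\<^bsub>Aut6\<^esub>" using \<phi>.hom_one by simp
  have \<phi>_auto: "\<phi> g \<in> auto (alt_group 6)" if "g \<in> carrier G" for g
    using bij_betw_apply[OF bij that] H.mem_carrier Aut6_simps(1) by blast

  define K where "K = generate G S"
  have SG: "S \<subseteq> carrier G" and two: "card (rcosets\<^bsub>G\<^esub> K) = 2"
    using S unfolding mixed_beauville_structure_def K_def by blast+
  obtain x y z where Sxyz: "S = {x, y, z}"
    and beau: "\<And>g. g \<in> carrier G - K \<Longrightarrow>
        x \<otimes>\<^bsub>G\<^esub> y \<otimes>\<^bsub>G\<^esub> z = \<one>\<^bsub>G\<^esub> \<and>
        beauville_Sigma G K x y z \<inter>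
          beauville_Sigma G K (conj_by G x g) (conj_by G y g) (conj_by G z g) = {\<one>\<^bsub>G\<^esub>} \<and>
        g [^]\<^bsub>G\<^esub> (2::nat) \<notin> beauville_Sigma G K x y z"
    using S unfolding mixed_beauville_structure_def K_def by blast
  have KG: "subgroup K G" unfolding K_def by (rule G.generate_is_subgroup[OF SG])
  interpret K: subgroup K G by (rule KG)
  obtain g0 where g0: "g0 \<in> carrier G - K" by (rule G.index_two_proper[OF KG two])
  have \<phi>_K: "\<phi> g \<in> \<phi> ` K \<longleftrightarrow> g \<in> K" if "g \<in> carrier G" for g
    using \<phi>_inj[OF that K.mem_carrier] by blast
  have sub\<phi>K: "subgroup (\<phi> ` K) Aut6"
    by (rule Au.incl_subgroup[OF assms(2) \<phi>.subgroup_img_is_subgroup[OF KG]])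
  have outside: "\<exists>g\<in>carrier G - K. \<alpha> = \<phi> g" if "\<alpha> \<in> H - \<phi> ` K" for \<alpha>
  proof -
    have "\<alpha> \<in> \<phi> ` carrier G" using that bij_betw_imp_surj_on[OF bij] by blast
    then show ?thesis using that by blast
  qed
  have "\<phi> ` K \<subseteq> H" using bij_betw_apply[OF bij] K.mem_carrier by blast
  moreover have "\<phi> g0 \<in> H" "\<phi> g0 \<notin> \<phi> ` K" using g0 bij_betw_apply[OF bij] \<phi>_K by blast+
  ultimately have proper: "\<phi> ` K \<subset> H" by blast
  have prod: "\<alpha> \<otimes>\<^bsub>Aut6\<^esub> \<beta> \<in> \<phi> ` K" if "\<alpha> \<in> H - \<phi> ` K" "\<beta> \<in> H - \<phi> ` K" for \<alpha> \<beta>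
  proof -
    from that[THEN outside] obtain g h
      where g: "g \<in> carrier G - K" "\<alpha> = \<phi> g" and h: "h \<in> carrier G - K" "\<beta> = \<phi> h"
      by blast
    have "\<phi> (g \<otimes>\<^bsub>G\<^esub> h) \<in> \<phi> ` K"
      using G.mult_in_index_two_subgroup[OF KG two g(1) h(1)] by (rule imageI)
    then show ?thesis using \<phi>_mult g h by simp
  qed
  consider (inner) "\<phi> ` K = ?I"
    | (involution) \<alpha> where "\<alpha> \<in> H - \<phi> ` K" "\<alpha> \<otimes>\<^bsub>Aut6\<^esub> \<alpha> = \<one>\<^bsub>Aut6\<^esub>"
    using index_two_in_Aut6[OF assms(2) inn sub\<phi>K proper prod] by metis
  then show False
  proof cases
    case involution
    then obtain g where g: "g \<in> carrier G - K" "\<alpha> = \<phi> g"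
      using outside by metis
    have "\<phi> (g \<otimes>\<^bsub>G\<^esub> g) = \<phi> \<one>\<^bsub>G\<^esub>" using \<phi>_mult \<phi>_one g involution(2) by simp
    then have "g \<otimes>\<^bsub>G\<^esub> g = \<one>\<^bsub>G\<^esub>" using \<phi>_inj g(1) by blast
    then have "g [^]\<^bsub>G\<^esub> (2::nat) = \<one>\<^bsub>G\<^esub>" using g(1) by (simp add: numeral_2_eq_2)
    moreover have "\<one>\<^bsub>G\<^esub> \<in> beauville_Sigma G K x y z"
      using beauville_SigmaI[OF K.one_closed, of x x y z G 0] by simp
    ultimately show False using beau[OF g(1)] by simp
  next
    case inner
    \<comment> \<open>the embedding of \<open>A6\<close> into \<open>G\<close> whose image is \<open>K\<close>\<close>
    define \<iota> where "\<iota> p = inv_into (carrier G) \<phi> (conj_aut p)" for p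
    have \<iota>: "\<iota> p \<in> carrier G" "\<phi> (\<iota> p) = conj_aut p" if "p \<in> ?A" for p
    proof -
      have "conj_aut p \<in> \<phi> ` carrier G" using that inn bij by (auto simp: bij_betw_def)
      then show "\<iota> p \<in> carrier G" "\<phi> (\<iota> p) = conj_aut p"
        unfolding \<iota>_def by (rule inv_into_into, rule f_inv_into_f)
    qed
    have \<iota>_eq: "g = \<iota> p" if "g \<in> carrier G" "p \<in> ?A" "\<phi> g = conj_aut p" for g p
      using \<phi>_inj[OF that(1) \<iota>(1)[OF that(2)]] \<iota>(2)[OF that(2)] that(3) by simp
    have \<iota>_mult: "\<iota> (p \<circ> q) = \<iota> p \<otimes>\<^bsub>G\<^esub> \<iota> q" if "p \<in> ?A" "q \<in> ?A" for p q
    proof (rule sym, rule \<iota>_eq)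
      show "\<phi> (\<iota> p \<otimes>\<^bsub>G\<^esub> \<iota> q) = conj_aut (p \<circ> q)"
        using \<phi>_mult[OF \<iota>(1) \<iota>(1)] \<iota>(2) that conj_aut_mult[OF alt_permutes alt_permutes] by simp
    qed (use that \<iota>(1) alt_comp in auto)
    interpret \<iota>: group_hom "alt_group 6" G \<iota>
      by unfold_locales (auto simp: hom_def \<iota>(1) \<iota>_mult alt_group_mult)
    have \<iota>_one: "p = id" if "p \<in> ?A" "\<iota> p = \<one>\<^bsub>G\<^esub>" for p
      using conj_aut_trivial[OF alt_permutes[OF that(1)]] \<iota>(2)[OF that(1)] that(2) \<phi>_one by simp
    have \<iota>_K: "\<iota> p \<in> K" if "p \<in> ?A" for p
      using \<phi>_K[OF \<iota>(1)[OF that]] \<iota>(2)[OF that] that unfolding inner by simp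
    have K_\<iota>: "\<exists>a\<in>?A. s = \<iota> a" if "s \<in> K" for s
    proof -
      have "\<phi> s \<in> ?I" using that inner by blast
      then show ?thesis using \<iota>_eq[OF K.mem_carrier[OF that]] by blast
    qed
    have \<iota>_pow: "\<iota> (a ^^ m) = \<iota> a [^]\<^bsub>G\<^esub> m" if "a \<in> ?A" for a and m :: nat
      using \<iota>.hom_nat_pow[OF that, of m] by (simp only: alt_group_pow)
    have pow_closed: "a ^^ m \<in> ?A" if "a \<in> ?A" for a and m :: nat
      using A.nat_pow_closed[OF that, of m] by (simp only: alt_group_pow)

    \<comment> \<open>otherwise \<open>\<Sigma>(x, y, z)\<close> meets its conjugate in a power of order 2 or 5\<close>
    have cube: "a ^^ 3 = id" if s: "s \<in> {x, y, z}" and a: "a \<in> ?A" and sa: "s = \<iota> a" for s a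
    proof (rule ccontr)
      assume "a ^^ 3 \<noteq> id"
      then obtain m n where n: "n \<in> {2, 5}" and b: "a ^^ m \<noteq> id" "(a ^^ m) ^^ n = id"
        using alt_group_6_order_cases[OF a] by blast
      have g0G: "g0 \<in> carrier G" using g0 by blast
      define \<gamma> where "\<gamma> = \<phi> (inv\<^bsub>G\<^esub> g0)"
      have \<gamma>: "\<gamma> \<in> auto (alt_group 6)" unfolding \<gamma>_def by (rule \<phi>_auto[OF G.inv_closed[OF g0G]])
      note C = auto_alt_groupD[OF \<gamma>]
      have bA: "a ^^ m \<in> ?A" by (rule pow_closed[OF a])
      have conj: "conj_by G s g0 = \<iota> (\<gamma> a)"
      proof (rule \<iota>_eq)
        show "conj_by G s g0 \<in> carrier G" unfolding conj_by_def sa using \<iota>(1)[OF a] g0G by simp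
        show "\<gamma> a \<in> ?A" by (rule C(1)[OF a])
        have "\<phi> (conj_by G s g0) = (\<gamma> \<otimes>\<^bsub>Aut6\<^esub> conj_aut a) \<otimes>\<^bsub>Aut6\<^esub> \<phi> g0"
          unfolding conj_by_def sa \<gamma>_def using \<iota>[OF a] g0G by (simp add: \<phi>_mult del: \<phi>.hom_inv)
        also have "\<dots> = conj_aut (\<gamma> a)"
        proof (rule conj_aut_conjugate[OF \<gamma> \<phi>_auto[OF g0G] _ a])
          show "\<gamma> \<otimes>\<^bsub>Aut6\<^esub> \<phi> g0 = \<one>\<^bsub>Aut6\<^esub>"
            unfolding \<gamma>_def \<phi>_mult[OF G.inv_closed[OF g0G] g0G, symmetric] G.l_inv[OF g0G]
            by (rule \<phi>_one)
        qed
        finally show "\<phi> (conj_by G s g0) = conj_aut (\<gamma> a)" .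
      qed
      have "\<gamma> (a ^^ m) \<noteq> id" "\<gamma> (a ^^ m) ^^ n = id"
        using b C(3) C(4)[OF bA A.one_closed[unfolded alt_group_one]] C(5)[OF bA, of n] by auto
      then obtain h k where h: "h \<in> ?A" and hk: "\<gamma> (a ^^ m) = h \<circ> (a ^^ m) ^^ k \<circ> inv' h"
        using alt_group_6_conjugate_to_power[OF n bA b C(1)[OF bA]] by blast
      have w1: "\<iota> (\<gamma> (a ^^ m)) = conj_by G s g0 [^]\<^bsub>G\<^esub> m"
        unfolding conj C(5)[OF a] by (rule \<iota>_pow[OF C(1)[OF a]])
      have "\<iota> (\<gamma> (a ^^ m)) = \<iota> h \<otimes>\<^bsub>G\<^esub> (\<iota> (a ^^ m) [^]\<^bsub>G\<^esub> k) \<otimes>\<^bsub>G\<^esub> inv\<^bsub>G\<^esub> (\<iota> h)"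
        unfolding hk using h bA pow_closed[OF bA] alt_group_inv_closed[OF h] \<iota>.hom_inv[OF h]
        by (simp add: \<iota>_mult alt_comp \<iota>_pow alt_group_inv_equality)
      then have "\<iota> (\<gamma> (a ^^ m)) = \<iota> h \<otimes>\<^bsub>G\<^esub> (s [^]\<^bsub>G\<^esub> (m * k)) \<otimes>\<^bsub>G\<^esub> inv\<^bsub>G\<^esub> (\<iota> h)"
        unfolding \<iota>_pow[OF a] sa using \<iota>(1)[OF a] by (simp add: G.nat_pow_pow)
      then have "\<iota> (\<gamma> (a ^^ m)) \<in> beauville_Sigma G K x y z"
        using beauville_SigmaI[OF \<iota>_K[OF h] s] by simp
      moreover have "\<iota> (\<gamma> (a ^^ m)) \<in> beauville_Sigma G K (conj_by G x g0) (conj_by G y g0) (conj_by G z g0)"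
      proof -
        have "conj_by G s g0 \<in> {conj_by G x g0, conj_by G y g0, conj_by G z g0}" using s by blast
        from beauville_SigmaI[OF K.one_closed this, of G m] show ?thesis
          unfolding w1 using \<iota>(1)[OF C(1)[OF a]] by (simp add: conj)
      qed
      ultimately have "\<iota> (\<gamma> (a ^^ m)) = \<one>\<^bsub>G\<^esub>" using beau[OF g0] by blast
      then show False using \<iota>_one[OF C(1)[OF bA]] \<open>\<gamma> (a ^^ m) \<noteq> id\<close> by blast
    qed

    have SK: "x \<in> K" "y \<in> K" "z \<in> K" unfolding K_def Sxyz by (auto intro: generate.incl)
    obtain a b c where a: "a \<in> ?A" "x = \<iota> a" and b: "b \<in> ?A" "y = \<iota> b" and c: "c \<in> ?A" "z = \<iota> c"
      using K_\<iota> SK by metis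
    have xyz: "x \<otimes>\<^bsub>G\<^esub> y \<otimes>\<^bsub>G\<^esub> z = \<one>\<^bsub>G\<^esub>" using beau[OF g0] by blast
    have "\<iota> (a \<circ> b \<circ> c) = \<one>\<^bsub>G\<^esub>" using xyz a b c by (simp add: \<iota>_mult alt_comp)
    then have "a \<circ> b \<circ> c = id" using a b c by (intro \<iota>_one alt_comp) auto
    then have ab: "a \<otimes>\<^bsub>alt_group 6\<^esub> b = inv\<^bsub>alt_group 6\<^esub> c"
      using a b c A.inv_equality[of "a \<circ> b" c] by (simp add: alt_group_mult alt_group_one alt_comp)
    have three: "t \<otimes>\<^bsub>alt_group 6\<^esub> t \<otimes>\<^bsub>alt_group 6\<^esub> t = \<one>\<^bsub>alt_group 6\<^esub>" if "t ^^ 3 = id" for t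
      using that unfolding alt_group_mult alt_group_one numeral_3_eq_3 funpow.simps comp_id comp_assoc .
    have a3: "a ^^ 3 = id" and b3: "b ^^ 3 = id" and c3: "c ^^ 3 = id"
      using cube a b c by blast+
    have xyG: "{x, y} \<subseteq> carrier G" using SG Sxyz by blast
    have z_gen: "z \<in> generate G {x, y}"
    proof -
      have "inv\<^bsub>G\<^esub> z = x \<otimes>\<^bsub>G\<^esub> y" using xyz SG Sxyz by (intro G.inv_equality) auto
      then have "z = inv\<^bsub>G\<^esub> (x \<otimes>\<^bsub>G\<^esub> y)" using SG Sxyz G.inv_inv[of z] by simp
      then show ?thesis
        using subgroup.m_inv_closed[OF G.generate_is_subgroup[OF xyG]] generate.eng[of x G "{x, y}" y]
          generate.incl[of _ "{x, y}" G] by simp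
    qed
    have "generate (alt_group 6) {a, b} = ?A"
    proof
      show "generate (alt_group 6) {a, b} \<subseteq> ?A" using a b by (intro A.generate_incl) auto
      show "?A \<subseteq> generate (alt_group 6) {a, b}"
      proof
        fix d assume d: "d \<in> ?A"
        have "K \<subseteq> generate G {x, y}"
          unfolding K_def Sxyz using z_gen
          by (intro G.generate_subgroup_incl G.generate_is_subgroup xyG) (auto intro: generate.incl)
        also have "generate G {x, y} = \<iota> ` generate (alt_group 6) {a, b}"
          using \<iota>.generate_img[of "{a, b}"] a b by simp
        finally obtain e where e: "e \<in> generate (alt_group 6) {a, b}" "\<iota> d = \<iota> e"
          using \<iota>_K[OF d] by blast
        have eA: "e \<in> ?A" using e(1) A.generate_incl[of "{a, b}"] a b by blast
        have "\<iota> (d \<otimes>\<^bsub>alt_group 6\<^esub> inv\<^bsub>alt_group 6\<^esub> e) = \<one>\<^bsub>G\<^esub>"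
          using \<iota>.hom_mult[OF d A.inv_closed[OF eA]] \<iota>.hom_inv[OF eA] e(2) \<iota>(1)[OF eA] by simp
        then have "d \<otimes>\<^bsub>alt_group 6\<^esub> inv\<^bsub>alt_group 6\<^esub> e = \<one>\<^bsub>alt_group 6\<^esub>"
          using \<iota>_one[OF A.m_closed[OF d A.inv_closed[OF eA]]] unfolding alt_group_one by blast
        then have "d = e" using A.inv_unique'[of d "inv\<^bsub>alt_group 6\<^esub> e"] A.inv_inv[OF eA] d eA
          by (metis A.inv_closed A.inv_equality)
        then show "d \<in> generate (alt_group 6) {a, b}" using e(1) by simp
      qed
    qed
    moreover have "inv\<^bsub>alt_group 6\<^esub> c \<otimes>\<^bsub>alt_group 6\<^esub> inv\<^bsub>alt_group 6\<^esub> c \<otimes>\<^bsub>alt_group 6\<^esub> inv\<^bsub>alt_group 6\<^esub> c = \<one>\<^bsub>alt_group 6\<^esub>"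
      using three[OF c3] c(1) by (metis A.inv_mult_group A.inv_one A.m_assoc A.m_closed)
    ultimately have "solvable (alt_group 6)"
      using A.triangle_333_solvable[OF a(1) b(1) _ three[OF a3] three[OF b3]] unfolding ab by blast
    then show False using alt_group_is_unsolvable[of 6] by simp
  qed
qed

end
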